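(* Let $0<\alpha_2<\alpha_1<1$, $c_1,c_2\ge0$, $c_1+c_2=1$. The Laplace transform $\tilde p_0^{\alpha_1,\alpha_2}(z)=\int_0^\infty e^{-zt}p_0^{\alpha_1,\alpha_2}(t)\,\mathrm dt$, $z>0$, of the zero state probability of the mixed time-changed Erlang queue $\{\mathcal Q^{\alpha_1,\alpha_2}(t)\}_{t\ge0}$ is $$\tilde p_0^{\alpha_1,\alpha_2}(z)=\sum_{m=1}^\infty\sum_{r=0}^\infty A^0_{m,r}\,\frac{c_1z^{\alpha_1-1}+c_2z^{\alpha_2-1}}{(\lambda+k\mu+c_1z^{\alpha_1}+c_2z^{\alpha_2})^{a^0_{m,r}}},$$ where $a^0_{m,r}=m+r(k+1)$ and $A^0_{m,r}=\dfrac{m\lambda^r(k\mu)^{m+rk-1}}{r!\,(m+rk)!}\,(m+r(k+1)-1)!$.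
   Context: Parameters: $\lambda>0$, $\mu>0$, $k\in\mathbb N=\{1,2,\dots\}$. Erlang queue: single-server queue with Poisson arrivals of rate $\lambda$, each service consisting of $k$ successive phases, each exponential with parameter $k\mu$, all independent. $\mathcal Q(t)=(\mathcal N(t),\mathcal S(t))$, where $\mathcal N(t)$ is the number of customers in the system and $\mathcal S(t)$ is the phase of the customer being served if $\mathcal N(t)>0$ (phases are counted down: service starts at phase $k$ and ends upon completion of phase $1$), with $\mathcal S(t)=0$ if $\mathcal N(t)=0$. Thus $\mathcal Q$ is the continuous-time Markov chain on $\mathcal H_0=\mathcal H\cup\{(0,0)\}$, $\mathcal H=\{(n,s)\in\mathbb N\times\mathbb N: s\le k\}$, with $\mathcal Q(0)=(0,0)$ and transition rates: $(0,0)\to(1,k)$ at rate $\lambda$; $(n,s)\to(n+1,s)$ at rate $\lambda$; $(n,s)\to(n,s-1)$ at rate $k\mu$ if $s\ge2$; $(n,1)\to(n-1,k)$ at rate $k\mu$ if $n\ge2$; $(1,1)\to(0,0)$ at rate $k\mu$. Inverse mixed stable subordinator: $\{D_{\alpha_1,\alpha_2}(t)\}_{t\ge0}$ is the nondecreasing Lévy process (started at $0$) with $\mathbb E(e^{-zD_{\alpha_1,\alpha_2}(t)})=e^{-t(c_1z^{\alpha_1}+c_2z^{\alpha_2})}$, $z>0$; $Y_{\alpha_1,\alpha_2}(t)=\inf\{s\ge0:D_{\alpha_1,\alpha_2}(s)>t\}$, $t>0$, $Y_{\alpha_1,\alpha_2}(0)=0$. Mixed time-changed Erlang queue: $\mathcal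 Q^{\alpha_1,\alpha_2}(t)=\mathcal Q(Y_{\alpha_1,\alpha_2}(t))$, with $\mathcal Q$ and $Y_{\alpha_1,\alpha_2}$ independent. Its zero state probability is $p_0^{\alpha_1,\alpha_2}(t)=\Pr(\mathcal Q^{\alpha_1,\alpha_2}(t)=(0,0)\mid \mathcal Q^{\alpha_1,\alpha_2}(0)=(0,0))$. *)

theory Defs
  imports "HOL-Probability.Probability"
begin

text \<open>
  A time-homogeneous continuous-time Markov chain on a state space \<open>S\<close> with off-diagonal transition
  rates \<open>r i j\<close>: a right-continuous \<open>S\<close>-valued process with the Markov property for some transition
  semigroup \<open>P\<close> whose derivative at time 0 is the conservative generator determined by \<open>r\<close>.
  Only \<open>P t i\<close> with \<open>t \<ge> 0\<close> and \<open>i \<in> S\<close>, and only \<open>r i j\<close> with \<open>i \<noteq> j\<close> in \<open>S\<close>, are relevant.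
  Right-continuity refers to the discrete topology on \<open>S\<close>.
\<close>

definition transition_semigroup :: "'s set \<Rightarrow> (real \<Rightarrow> 's \<Rightarrow> 's pmf) \<Rightarrow> bool" where
  "transition_semigroup S P \<longleftrightarrow>
     (\<forall>i\<in>S. P 0 i = return_pmf i) \<and>
     (\<forall>t\<ge>0. \<forall>i\<in>S. set_pmf (P t i) \<subseteq> S) \<and>
     (\<forall>s\<ge>0. \<forall>t\<ge>0. \<forall>i\<in>S. P (s + t) i = bind_pmf (P s i) (P t))"

definition has_transition_rates :: "'s set \<Rightarrow> (real \<Rightarrow> 's \<Rightarrow> 's pmf) \<Rightarrow> ('s \<Rightarrow> 's \<Rightarrow> real) \<Rightarrow> bool" where
  "has_transition_rates S P r \<longleftrightarrow>
     (\<forall>i\<in>S. \<forall>j\<in>S - {i}. ((\<lambda>h. pmf (P h i) j / h) \<longlongrightarrow> r i j) (at_right 0)) \<and>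
     (\<forall>i\<in>S. (r i) summable_on (S - {i}) \<and>
        ((\<lambda>h. (1 - pmf (P h i) i) / h) \<longlongrightarrow> (\<Sum>\<^sub>\<infinity>j\<in>S - {i}. r i j)) (at_right 0))"

definition (in prob_space) markov_chain ::
    "'s set \<Rightarrow> ('s \<Rightarrow> 's \<Rightarrow> real) \<Rightarrow> (real \<Rightarrow> 'a \<Rightarrow> 's) \<Rightarrow> bool" where
  "markov_chain S r X \<longleftrightarrow>
     (\<forall>t\<ge>0. random_variable (count_space S) (X t)) \<and>
     (\<forall>\<omega>\<in>space M. \<forall>t\<ge>0. \<forall>\<^sub>F s in at_right t. X s \<omega> = X t \<omega>) \<and>
     (\<exists>P. transition_semigroup S P \<and> has_transition_rates S P r \<and>
        (\<forall>(n::nat) (t::nat \<Rightarrow> real) (x::nat \<Rightarrow> 's).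
           0 \<le> t 0 \<longrightarrow> (\<forall>m\<le>n. t m < t (Suc m)) \<longrightarrow>
           \<P>(\<omega> in M. \<forall>m\<le>n. X (t m) \<omega> = x m) \<noteq> 0 \<longrightarrow>
           \<P>(\<omega> in M. X (t (Suc n)) \<omega> = x (Suc n) \<bar> \<forall>m\<le>n. X (t m) \<omega> = x m)
             = pmf (P (t (Suc n) - t n) (x n)) (x (Suc n))))"

definition erlang_states :: "nat \<Rightarrow> (nat \<times> nat) set" where
  "erlang_states k = insert (0, 0) {(n, s). 1 \<le> n \<and> 1 \<le> s \<and> s \<le> k}"

definition erlang_rate :: "real \<Rightarrow> real \<Rightarrow> nat \<Rightarrow> nat \<times> nat \<Rightarrow> nat \<times> nat \<Rightarrow> real" where
  "erlang_rate lam mu k x y = (case x of (n, s) \<Rightarrow>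
     if n = 0 then (if y = (1, k) then lam else 0)
     else if y = (n + 1, s) then lam
     else if s \<ge> 2 \<and> y = (n, s - 1) then real k * mu
     else if s = 1 \<and> n \<ge> 2 \<and> y = (n - 1, k) then real k * mu
     else if s = 1 \<and> n = 1 \<and> y = (0, 0) then real k * mu
     else 0)"

definition (in prob_space) erlang_queue ::
    "real \<Rightarrow> real \<Rightarrow> nat \<Rightarrow> (real \<Rightarrow> 'a \<Rightarrow> nat \<times> nat) \<Rightarrow> bool" where
  "erlang_queue lam mu k Q \<longleftrightarrow>
     markov_chain (erlang_states k) (erlang_rate lam mu k) Q \<and> (AE \<omega> in M. Q 0 \<omega> = (0, 0))"

definition (in prob_space) levy_process :: "(real \<Rightarrow> 'a \<Rightarrow> real) \<Rightarrow> bool" where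
  "levy_process X \<longleftrightarrow>
     (\<forall>t\<ge>0. random_variable borel (X t)) \<and>
     (AE \<omega> in M. X 0 \<omega> = 0) \<and>
     (\<forall>(n::nat) (t::nat \<Rightarrow> real). 0 \<le> t 0 \<longrightarrow> (\<forall>i<n. t i < t (Suc i)) \<longrightarrow>
        indep_vars (\<lambda>_. borel) (\<lambda>i \<omega>. X (t (Suc i)) \<omega> - X (t i) \<omega>) {..<n}) \<and>
     (\<forall>s\<ge>0. \<forall>h\<ge>0. distr M borel (\<lambda>\<omega>. X (s + h) \<omega> - X s \<omega>) = distr M borel (X h)) \<and>
     (AE \<omega> in M. \<forall>t\<ge>0. continuous (at_right t) (\<lambda>s. X s \<omega>)) \<and>
     (AE \<omega> in M. \<forall>t>0. \<exists>l. ((\<lambda>s. X s \<omega>) \<longlongrightarrow> l) (at_left t))"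

definition (in prob_space) mixed_stable_subordinator ::
    "real \<Rightarrow> real \<Rightarrow> real \<Rightarrow> real \<Rightarrow> (real \<Rightarrow> 'a \<Rightarrow> real) \<Rightarrow> bool" where
  "mixed_stable_subordinator c\<^sub>1 c\<^sub>2 \<alpha>\<^sub>1 \<alpha>\<^sub>2 D \<longleftrightarrow>
     levy_process D \<and>
     (AE \<omega> in M. \<forall>s\<ge>0. \<forall>t\<ge>s. D s \<omega> \<le> D t \<omega>) \<and>
     (\<forall>t\<ge>0. \<forall>z>0. expectation (\<lambda>\<omega>. exp (- z * D t \<omega>))
        = exp (- t * (c\<^sub>1 * z powr \<alpha>\<^sub>1 + c\<^sub>2 * z powr \<alpha>\<^sub>2)))"

text \<open>
  The paths of a mixed stable subordinator are almost surely unbounded. On the null event where the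
  level \<open>t\<close> is never exceeded, the first passage time would be infinite; it is set to 0 there, to
  keep it a nonnegative real.
\<close>

definition inverse_process :: "(real \<Rightarrow> 'a \<Rightarrow> real) \<Rightarrow> real \<Rightarrow> 'a \<Rightarrow> real" where
  "inverse_process D t \<omega> =
     (if t = 0 \<or> {s. 0 \<le> s \<and> t < D s \<omega>} = {} then 0 else Inf {s. 0 \<le> s \<and> t < D s \<omega>})"

text \<open>
  Independence of the generated sigma-algebras; the library's \<open>indep_var\<close> needs both random
  elements to have the same type.
\<close>

definition process_algebra ::
    "'a measure \<Rightarrow> 's measure \<Rightarrow> (real \<Rightarrow> 'a \<Rightarrow> 's) \<Rightarrow> 'a measure" where
  "process_algebra M N X =
     vimage_algebra (space M) (\<lambda>\<omega>. \<lambda>t\<in>{0..}. X t \<omega>) (Pi\<^sub>M {0..} (\<lambda>_. N))"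

definition (in prob_space) indep_processes ::
    "'s measure \<Rightarrow> (real \<Rightarrow> 'a \<Rightarrow> 's) \<Rightarrow> 't measure \<Rightarrow> (real \<Rightarrow> 'a \<Rightarrow> 't) \<Rightarrow> bool" where
  "indep_processes N\<^sub>1 X N\<^sub>2 Y \<longleftrightarrow>
     (\<forall>t\<ge>0. random_variable N\<^sub>1 (X t)) \<and> (\<forall>t\<ge>0. random_variable N\<^sub>2 (Y t)) \<and>
     indep_set (sets (process_algebra M N\<^sub>1 X)) (sets (process_algebra M N\<^sub>2 Y))"

definition time_change :: "(real \<Rightarrow> 'a \<Rightarrow> 's) \<Rightarrow> (real \<Rightarrow> 'a \<Rightarrow> real) \<Rightarrow> real \<Rightarrow> 'a \<Rightarrow> 's" where
  "time_change X Y t \<omega> = X (Y t \<omega>) \<omega>"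

definition zero_state_prob :: "'a measure \<Rightarrow> (real \<Rightarrow> 'a \<Rightarrow> nat \<times> nat) \<Rightarrow> real \<Rightarrow> real" where
  "zero_state_prob M X t = \<P>(\<omega> in M. X t \<omega> = (0, 0) \<bar> X 0 \<omega> = (0, 0))"

definition laplace_transform :: "(real \<Rightarrow> real) \<Rightarrow> real \<Rightarrow> real" where
  "laplace_transform f z = (LINT t:{0..}|lborel. exp (- z * t) * f t)"

definition a0 :: "nat \<Rightarrow> nat \<Rightarrow> nat \<Rightarrow> nat" where
  "a0 k m r = m + r * (k + 1)"

definition A0 :: "real \<Rightarrow> real \<Rightarrow> nat \<Rightarrow> nat \<Rightarrow> nat \<Rightarrow> real" where
  "A0 lam mu k m r =
     real m * lam ^ r * (real k * mu) ^ (m + r * k - 1) / (fact r * fact (m + r * k))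
       * fact (m + r * (k + 1) - 1)"

definition zero_state_term ::
    "real \<Rightarrow> real \<Rightarrow> nat \<Rightarrow> real \<Rightarrow> real \<Rightarrow> real \<Rightarrow> real \<Rightarrow> real \<Rightarrow> nat \<Rightarrow> nat \<Rightarrow> real" where
  "zero_state_term lam mu k c\<^sub>1 c\<^sub>2 \<alpha>\<^sub>1 \<alpha>\<^sub>2 z m r =
     A0 lam mu k m r *
       ((c\<^sub>1 * z powr (\<alpha>\<^sub>1 - 1) + c\<^sub>2 * z powr (\<alpha>\<^sub>2 - 1)) /
        (lam + real k * mu + c\<^sub>1 * z powr \<alpha>\<^sub>1 + c\<^sub>2 * z powr \<alpha>\<^sub>2) ^ a0 k m r)"

end

theory Submission
  imports Defs
begin

text \<open>
  Write \<open>\<phi> z = c\<^sub>1 * z powr \<alpha>\<^sub>1 + c\<^sub>2 * z powr \<alpha>\<^sub>2\<close>. The inverse subordinator evaluated at an independent exponential time of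
  rate \<open>z\<close> is exponential of rate \<open>\<phi> z\<close>, so the Laplace transform of the time-changed zero state
  probability at \<open>z\<close> is \<open>\<phi> z / z\<close> times that of the original one at \<open>s = \<phi> z\<close>. The latter solves the
  resolvent equations of the queue, whose only bounded solution is \<open>\<rho>\<^sup>l / (k * mu) * (\<rho> + \<rho>\<^sup>2 + ...)\<close> in
  the number \<open>l\<close> of remaining phases, where \<open>\<rho> \<in> (0, 1)\<close> and
  \<open>(lam + k * mu + s) * \<rho> = k * mu + lam * \<rho>^(k + 1)\<close>. Expanding each \<open>\<rho>\<^sup>m\<close> by Lagrange inversion gives the double
  series.
\<close>

text \<open>Uniqueness is where positivity of the Laplace variable acts. Killing at rate
  \<open>s\<close> makes the resolvent equations a contraction with factor (lam + k * mu) / (s + lam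
  + k * mu), so a bounded solution is determined although each equation refers to levels both above
  and below. The same factor, in the form \<open>p + q\<close>, identifies the sum of the Raney
  series. The exponential law of the time change rests on the events Y(T) < u, T < D(u), Y(T) \<le>
  u, each contained in the next up to a null set for an exponential time T independent of D; the
  middle one has probability 1 - E exp (- z * D(u)). Two obstacles shape the rest. The rates are
  known only as derivatives at time 0, so the resolvent equations come from differentiating, in the
  shift \<open>h\<close> at 0, the Laplace transform of a transition probability shifted by
  \<open>h\<close>. And the queue is measurable at fixed times only, so its value at a random time
  is reached through grid times from the right.\<close>

section \<open>Raney numbers\<close>

text \<open>
  The coefficients of \<open>\<rho>\<^sup>m\<close> when \<open>\<rho> = p + q * \<rho>^(k + 1)\<close> is solved by Lagrange inversion; the closed
  formula would give 0 at \<open>m = r = 0\<close>.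
\<close>

definition raney :: "nat \<Rightarrow> nat \<Rightarrow> nat \<Rightarrow> real" where
  "raney k m r = (if m = 0 then of_bool (r = 0)
     else real m * fact (m + r * (k + 1) - 1) / (fact r * fact (m + r * k)))"

lemma raney_0_right: "raney k m 0 = 1"
  by (cases m) (simp_all add: raney_def)

lemma raney_nonneg: "0 \<le> raney k m r"
  by (simp add: raney_def)

text \<open>First step analysis: \<open>raney k m r\<close> counts the paths from level
  \<open>m\<close> to their first visit of 0 with \<open>r\<close> jumps up by \<open>k\<close> and
  otherwise unit steps down. From \<open>Suc m\<close> the first step leads to \<open>m\<close>, or
  to \<open>Suc m + k\<close> with one jump spent.\<close>

lemma raney_Suc_Suc: "raney k (Suc m) (Suc r) = raney k m (Suc r) + raney k (Suc m + k) r"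
proof -
  \<comment> \<open>The numerators contain (N + 1)!, N!, N! and the denominators (L + 1)!, L!, (L +
    1)!, so that only a polynomial identity in \<open>m\<close>, \<open>k\<close>, \<open>r\<close>
    is left.\<close>
  define N where "N = m + r * (k + 1) + k"
  define L where "L = m + Suc r * k"
  have 1: "raney k (Suc m) (Suc r) = real (Suc m) * fact (Suc N) / (fact (Suc r) * fact (Suc L))"
    unfolding raney_def N_def L_def by (simp add: algebra_simps)
  \<comment> \<open>At \<open>m = 0\<close> the exceptional value agrees with the closed formula,
    since \<open>Suc r\<close> is positive.\<close>
  have 2: "raney k m (Suc r) = real m * fact N / (fact (Suc r) * fact L)"
  proof (cases m)
    case (Suc m')
    then show ?thesis
      unfolding raney_def N_def L_def by (simp add: algebra_simps)
  qed (simp add: raney_def)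
  have 3: "raney k (Suc m + k) r = real (Suc m + k) * fact N / (fact r * fact (Suc L))"
    unfolding raney_def N_def L_def by (simp add: algebra_simps)
  have NL: "real N = real L + real r" "real L = m + (r + 1) * k"
    unfolding N_def L_def by (simp_all add: algebra_simps)
  define a b where "a = (fact N :: real)" and "b = (fact L :: real)"
  define c where "c = (fact r :: real)"
  have "b > 0" "c > 0" by (simp_all add: b_def c_def)
  have "real (Suc m) * real (Suc N) = real m * real (Suc L) + real (Suc m + k) * real (Suc r)"
    by (simp add: NL algebra_simps)
  then have "real (Suc m) * (real (Suc N) * a) / (real (Suc r) * c * (real (Suc L) * b)) =
        (real m * real (Suc L) + real (Suc m + k) * real (Suc r)) * a / (real (Suc r) * c * (real (Suc L) * b))"
    by (simp only: mult.assoc[symmetric])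
  also have "\<dots> = real m * a / (real (Suc r) * c * b) + real (Suc m + k) * a / (c * (real (Suc L) * b))"
  proof -
    have "(x * L' + y * R') * a / (R' * c * (L' * b)) = x * a / (R' * c * b) + y * a / (c * (L' * b))"
      if "0 < L'" "0 < R'" for x y L' R' :: real
      using that \<open>b > 0\<close> \<open>c > 0\<close> by (simp add: field_simps)
    then show ?thesis by (simp only: of_nat_0_less_iff zero_less_Suc)
  qed
  finally have "real (Suc m) * (real (Suc N) * a) / (real (Suc r) * c * (real (Suc L) * b)) =
        real m * a / (real (Suc r) * c * b) + real (Suc m + k) * a / (c * (real (Suc L) * b))" .
  then show ?thesis
    unfolding 1 2 3 fact_Suc a_def b_def c_def .
qed

text \<open>Iterating \<open>contr\<close> gives the bounds \<theta>^n * B. This yields uniqueness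
  for linear systems that cannot be solved index by index: the Raney recursion and the resolvent
  equations.\<close>

lemma contraction_imp_zero:
  fixes y :: "'i \<Rightarrow> real"
  assumes bound: "\<And>i. i \<in> S \<Longrightarrow> \<bar>y i\<bar> \<le> B"
    and contr: "\<And>b i. (\<And>j. j \<in> S \<Longrightarrow> \<bar>y j\<bar> \<le> b) \<Longrightarrow> i \<in> S \<Longrightarrow> \<bar>y i\<bar> \<le> \<theta> * b"
    and \<theta>: "0 \<le> \<theta>" "\<theta> < 1" and i: "i \<in> S"
  shows "y i = 0"
proof -
  have "\<bar>y i\<bar> \<le> \<theta> ^ n * B" if "i \<in> S" for n i
    using that
  proof (induction n arbitrary: i)
    case (Suc n)
    show ?case using contr[OF Suc.IH Suc.prems] by (simp add: mult.assoc)
  qed (simp add: bound)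
  moreover have "(\<lambda>n. \<theta> ^ n * B) \<longlonglongrightarrow> 0 * B"
    using \<theta> by (intro tendsto_intros LIMSEQ_realpow_zero)
  ultimately have "\<bar>y i\<bar> \<le> 0 * B"
    using i LIMSEQ_le_const by blast
  then show ?thesis by simp
qed

text \<open>The partial sums obey a truncated form of the recursion of the powers of \<rho>, stay
  below them and hence converge. The limits and the powers then solve one recursion with the same
  value at \<open>m = 0\<close>, and \<open>p + q < 1\<close> leaves only one bounded
  solution.\<close>

lemma raney_sums:
  fixes p q \<rho> :: real
  assumes p: "0 \<le> p" and q: "0 \<le> q" and pq: "p + q < 1"
    and \<rho>: "0 \<le> \<rho>" "\<rho> \<le> 1" "\<rho> = p + q * \<rho> ^ (k + 1)"
  shows "(\<lambda>r. raney k m r * q ^ r * p ^ (m + r * k)) sums \<rho> ^ m"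
proof -
  define f where "f m r = raney k m r * q ^ r * p ^ (m + r * k)" for m r
  define T where "T m n = (\<Sum>r<n. f m r)" for m n
  have f0: "f m r \<ge> 0" for m r
    using p q by (simp add: f_def raney_nonneg)
  have rec: "f (Suc m) (Suc r) = p * f m (Suc r) + q * f (Suc m + k) r" for m r
    unfolding f_def raney_Suc_Suc by (simp add: algebra_simps power_add)
  \<comment> \<open>The terms at r = 0 satisfy \<open>f (Suc m) 0 = p * f m 0\<close>; a jump uses
    up one unit of \<open>r\<close>, which shortens the last sum.\<close>
  have T: "T (Suc m) (Suc n) = p * T m (Suc n) + q * T (Suc m + k) n" for m n
    unfolding T_def sum.lessThan_Suc_shift rec
    by (simp add: sum.distrib sum_distrib_left algebra_simps)
       (simp add: f_def raney_0_right)
  have T0: "T 0 n \<le> 1" for n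
    unfolding T_def f_def raney_def by (cases n) (simp_all add: sum.lessThan_Suc_shift del: sum.lessThan_Suc)
  have \<rho>_rec: "\<rho> ^ Suc m = p * \<rho> ^ m + q * \<rho> ^ (Suc m + k)" for m
    using arg_cong[OF \<rho>(3), of "\<lambda>x. x * \<rho> ^ m"] by (simp add: algebra_simps power_add)
  \<comment> \<open>The outer induction serves the \<open>q\<close> term, whose first index grows;
    the inner one serves the \<open>p\<close> term at the same truncation.\<close>
  have le: "T m n \<le> \<rho> ^ m" for m n
  proof (induction n arbitrary: m)
    case 0
    then show ?case using \<rho> by (simp add: T_def)
  next
    case (Suc n)
    show ?case
    proof (induction m)
      case 0
      then show ?case using T0 by simp
    next
      case (Suc m)
      have "T (Suc m) (Suc n) \<le> p * \<rho> ^ m + q * \<rho> ^ (Suc m + k)"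
        unfolding T using Suc \<open>\<And>m. T m n \<le> \<rho> ^ m\<close> p q by (intro add_mono mult_left_mono) (auto simp del: power_Suc add_Suc)
      also have "\<dots> = \<rho> ^ Suc m" by (rule \<rho>_rec[symmetric])
      finally show ?case .
    qed
  qed
  have summ: "summable (f m)" for m
    using le f0 unfolding T_def by (intro bounded_imp_summable[of _ "\<rho> ^ m"]) (simp_all flip: lessThan_Suc_atMost del: sum.lessThan_Suc)
  define G where "G m = suminf (f m)" for m
  have TG: "(\<lambda>n. T m n) \<longlonglongrightarrow> G m" for m
    unfolding T_def G_def using summ by (rule summable_LIMSEQ)
  have G0: "G 0 = 1"
  proof -
    have "f 0 = (\<lambda>r. if r = 0 then 1 else 0)"
      by (auto simp: f_def raney_def)
    then show ?thesis unfolding G_def using sums_single[of 0 "\<lambda>_. 1::real"] by (simp add: sums_iff)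
  qed
  have G_rec: "G (Suc m) = p * G m + q * G (Suc m + k)" for m
  proof (rule LIMSEQ_unique)
    show "(\<lambda>n. T (Suc m) (Suc n)) \<longlonglongrightarrow> G (Suc m)"
      using TG by (rule LIMSEQ_Suc)
    show "(\<lambda>n. T (Suc m) (Suc n)) \<longlonglongrightarrow> p * G m + q * G (Suc m + k)"
      unfolding T by (intro tendsto_intros TG LIMSEQ_Suc[OF TG])
  qed
  have G_le: "0 \<le> G m" "G m \<le> \<rho> ^ m" for m
    using LIMSEQ_le_const2[OF TG] LIMSEQ_le_const[OF TG] le f0
    by (auto simp: T_def sum_nonneg)
  have \<rho>m: "\<rho> ^ m \<le> 1" for m using \<rho> by (simp add: power_le_one)
  have "G m - \<rho> ^ m = 0"
  proof (rule contraction_imp_zero[of UNIV "\<lambda>m. G m - \<rho> ^ m" 1 "p + q"])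
    show "\<bar>G i - \<rho> ^ i\<bar> \<le> 1" for i
      using G_le[of i] \<rho>m[of i] by linarith
    show "\<bar>G i - \<rho> ^ i\<bar> \<le> (p + q) * b" if b: "\<And>j. j \<in> UNIV \<Longrightarrow> \<bar>G j - \<rho> ^ j\<bar> \<le> b" for b i
    proof (cases i)
      case 0
      have "0 \<le> b" using b[of 0] by simp
      then show ?thesis using 0 G0 p q by simp
    next
      case (Suc n)
      have "G i - \<rho> ^ i = p * (G n - \<rho> ^ n) + q * (G (Suc n + k) - \<rho> ^ (Suc n + k))"
        unfolding Suc G_rec[of n] \<rho>_rec[of n] by (simp add: algebra_simps)
      also have "\<bar>\<dots>\<bar> \<le> p * \<bar>G n - \<rho> ^ n\<bar> + q * \<bar>G (Suc n + k) - \<rho> ^ (Suc n + k)\<bar>"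
        using p q by (intro order.trans[OF abs_triangle_ineq]) (simp add: abs_mult)
      also have "\<dots> \<le> p * b + q * b"
        using p q b by (intro add_mono mult_left_mono) (auto simp del: power_Suc add_Suc)
      finally show ?thesis by (simp add: algebra_simps)
    qed
  qed (use p q pq in auto)
  then show ?thesis
    using summ[of m] by (auto simp: G_def sums_iff f_def[abs_def])
qed

section \<open>Resolvent equations of a Markov semigroup\<close>

lemma exp_minus_set_integrable:
  assumes "0 < (s::real)"
  shows "set_integrable lborel {0..} (\<lambda>t. exp (- s * t))"
proof -
  have "(\<lambda>t. exp (- s * t)) absolutely_integrable_on {0..}"
    using has_integral_exp_minus_to_infinity[OF assms, of 0]
    by (intro nonnegative_absolutely_integrable_1) (auto simp: has_integral_iff)
  then show ?thesis
    unfolding set_integrable_def by (subst (asm) integrable_completion) auto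
qed

lemma laplace_set_integrable:
  fixes f :: "real \<Rightarrow> real"
  assumes s: "0 < s" and f: "set_borel_measurable lborel {0..} f"
    and B: "\<And>t. 0 \<le> t \<Longrightarrow> \<bar>f t\<bar> \<le> B"
  shows "set_integrable lborel {0..} (\<lambda>t. exp (- s * t) * f t)"
proof -
  have "set_integrable lborel {0..} (\<lambda>t. exp (- s * t) * B)"
    using exp_minus_set_integrable[OF s] by simp
  moreover have "set_borel_measurable lborel {0..} (\<lambda>t. exp (- s * t) * f t)"
  proof -
    have "(\<lambda>t. exp (- s * t) * (indicator {0..} t *\<^sub>R f t)) \<in> borel_measurable lborel"
      using f unfolding set_borel_measurable_def by (intro borel_measurable_times) auto
    then show ?thesis unfolding set_borel_measurable_def by (simp add: mult.left_commute)
  qed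
  ultimately show ?thesis
    by (rule set_integrable_bound) (auto simp: abs_mult intro!: AE_I2 order.trans[OF B])
qed

lemma continuous_laplace_set_integrable:
  fixes f :: "real \<Rightarrow> real"
  assumes "0 < s" and "continuous_on {0..} f" and "\<And>t. 0 \<le> t \<Longrightarrow> \<bar>f t\<bar> \<le> B"
  shows "set_integrable lborel {0..} (\<lambda>t. exp (- s * t) * f t)"
proof -
  have "set_borel_measurable lborel {0..} f"
    unfolding set_borel_measurable_def
    using borel_measurable_continuous_on_indicator[OF _ assms(2)] by (simp del: real_scaleR_def)
  then show ?thesis using assms by (intro laplace_set_integrable[of s f B])
qed

text \<open>The substitution of t for t + h leaves the tail of the integral beyond \<open>h\<close>.
  The missing initial piece is written as a gauge integral, to be differentiated in \<open>h\<close>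
  by the fundamental theorem.\<close>

lemma laplace_transform_shift:
  fixes f :: "real \<Rightarrow> real"
  assumes s: "0 < s" and f: "continuous_on {0..} f" and B: "\<And>t. 0 \<le> t \<Longrightarrow> \<bar>f t\<bar> \<le> B"
    and h: "0 \<le> h"
  shows "laplace_transform (\<lambda>t. f (t + h)) s =
    exp (s * h) * (laplace_transform f s - integral {0..h} (\<lambda>t. exp (- s * t) * f t))"
proof -
  let ?g = "\<lambda>t. exp (- s * t) * f t"
  have int: "set_integrable lborel {0..} ?g"
    using s f B by (rule continuous_laplace_set_integrable)
  have cont: "continuous_on {0..h} ?g"
    using f by (auto intro!: continuous_intros intro: continuous_on_subset)
  have "laplace_transform (\<lambda>t. f (t + h)) s = (\<integral>t. exp (s * h) * (indicator {h..} (t + h) * ?g (t + h)) \<partial>lborel)"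
    unfolding laplace_transform_def set_lebesgue_integral_def
    by (intro Bochner_Integration.integral_cong)
       (auto simp: indicator_def algebra_simps simp flip: exp_add)
  also have "\<dots> = (\<integral>t. exp (s * h) * (indicator {h..} t * ?g t) \<partial>lborel)"
    by (subst lborel_integral_real_affine[where c=1 and t=h]) (auto simp: add.commute)
  also have "\<dots> = exp (s * h) * (LINT t:{h..}|lborel. ?g t)"
    by (simp add: set_lebesgue_integral_def)
  also have "(LINT t:{h..}|lborel. ?g t) = laplace_transform f s - (LINT t:{0..h}|lborel. ?g t)"
  proof -
    \<comment> \<open>The two intervals overlap only in the null set {h}.\<close>
    have "(LINT t:{0..h} \<union> {h..}|lborel. ?g t) = (LINT t:{0..h}|lborel. ?g t) + (LINT t:{h..}|lborel. ?g t)"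
      using AE_lborel_singleton[of h] h
      by (intro set_integral_Un_AE set_integrable_subset[OF int]) (auto elim!: eventually_mono)
    moreover have "{0..h} \<union> {h..} = {0..}" using h by auto
    ultimately show ?thesis by (simp add: laplace_transform_def)
  qed
  also have "(LINT t:{0..h}|lborel. ?g t) = integral {0..h} ?g"
    using cont by (intro set_borel_integral_eq_integral borel_integrable_atLeastAtMost')
  finally show ?thesis .
qed

text \<open>The exponential factor contributes the \<open>s\<close> and the lost initial piece the
  \<open>- f 0\<close>. The derivative falls on the weight, so \<open>f\<close> itself is never
  differentiated.\<close>

lemma laplace_transform_shift_deriv:
  fixes f :: "real \<Rightarrow> real"
  assumes s: "0 < s" and f: "continuous_on {0..} f" and B: "\<And>t. 0 \<le> t \<Longrightarrow> \<bar>f t\<bar> \<le> B"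
  shows "((\<lambda>h. (laplace_transform (\<lambda>t. f (t + h)) s - laplace_transform f s) / h)
    \<longlongrightarrow> s * laplace_transform f s - f 0) (at_right 0)"
proof -
  let ?L = "laplace_transform f s"
  let ?I = "\<lambda>h. integral {0..h} (\<lambda>t. exp (- s * t) * f t)"
  have cont: "continuous_on {0..1} (\<lambda>t. exp (- s * t) * f t)"
    using f by (auto intro!: continuous_intros intro: continuous_on_subset)
  have "(?I has_vector_derivative f 0) (at_right 0)"
    using integral_has_vector_derivative[OF cont, of 0] by (simp add: at_within_Icc_at_right)
  then have I: "(?I has_field_derivative f 0) (at_right 0)"
    by (simp add: has_real_derivative_iff_has_vector_derivative)
  have "((\<lambda>h. exp (s * h) * (?L - ?I h)) has_field_derivative (s * ?L - f 0)) (at_right 0)"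
    by (rule derivative_eq_intros I refl | simp)+
  then have "((\<lambda>h. (exp (s * h) * (?L - ?I h) - ?L) / h) \<longlongrightarrow> s * ?L - f 0) (at_right 0)"
    by (simp add: has_field_derivative_iff)
  moreover have "\<forall>\<^sub>F h in at_right 0. (exp (s * h) * (?L - ?I h) - ?L) / h =
      (laplace_transform (\<lambda>t. f (t + h)) s - laplace_transform f s) / h"
    using laplace_transform_shift[OF s f B] by (auto simp: eventually_at_filter)
  ultimately show ?thesis by (rule Lim_transform_eventually)
qed

text \<open>Since \<open>f\<close> takes values in [0, 1], discarding the complement of
  \<open>A\<close> loses at most the mass there. Sums over infinitely many target states thus reduce
  to finite ones.\<close>

lemma pmf_integral_finite_approx:
  fixes f :: "'s \<Rightarrow> real"
  assumes f: "\<And>x. 0 \<le> f x" "\<And>x. f x \<le> 1" and A: "finite A"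
  shows "(\<Sum>x\<in>A. pmf p x * f x) \<le> measure_pmf.expectation p f"
    and "measure_pmf.expectation p f \<le> (\<Sum>x\<in>A. pmf p x * f x) + (1 - (\<Sum>x\<in>A. pmf p x))"
proof -
  have int: "integrable (measure_pmf p) g" if "\<And>x. \<bar>g x\<bar> \<le> 1" for g :: "'s \<Rightarrow> real"
    using that by (intro measure_pmf.integrable_const_bound[where B=1]) auto
  have ind: "integrable (measure_pmf p) (\<lambda>x. indicator A x * f x)"
      "integrable (measure_pmf p) f" "integrable (measure_pmf p) (\<lambda>x. indicator A x :: real)"
    using f by (auto intro!: int simp: indicator_def)
  have fin: "measure_pmf.expectation p (\<lambda>x. indicator A x * g x) = (\<Sum>x\<in>A. pmf p x * g x)" for g :: "'s \<Rightarrow> real"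
    using A by (subst integral_measure_pmf_real[of A]) (auto simp: indicator_def mult.commute intro!: sum.cong)
  have "measure_pmf.expectation p (\<lambda>x. indicator A x * f x) \<le> measure_pmf.expectation p f"
    using ind f by (intro integral_mono) (auto simp: indicator_def)
  then show "(\<Sum>x\<in>A. pmf p x * f x) \<le> measure_pmf.expectation p f"
    by (simp add: fin)
  have "measure_pmf.expectation p f \<le>
      measure_pmf.expectation p (\<lambda>x. indicator A x * f x + (1 - indicator A x))"
    using ind f by (intro integral_mono) (auto simp: indicator_def)
  also have "\<dots> = (\<Sum>x\<in>A. pmf p x * f x) + (1 - (\<Sum>x\<in>A. pmf p x))"
    using ind fin[of f] fin[of "\<lambda>_. 1"] by simp
  finally show "measure_pmf.expectation p f \<le> (\<Sum>x\<in>A. pmf p x * f x) + (1 - (\<Sum>x\<in>A. pmf p x))" .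
qed

text \<open>Chapman-Kolmogorov with the step \<open>h\<close> taken first, so that for small
  \<open>h\<close> the discarded mass is governed by the rates out of \<open>i\<close>.\<close>

lemma transition_semigroup_approx:
  assumes P: "transition_semigroup S P" and i: "i \<in> S" and h: "0 \<le> h" and u: "0 \<le> u"
    and A: "finite A"
  shows "(\<Sum>l\<in>A. pmf (P h i) l * pmf (P u l) j) \<le> pmf (P (u + h) i) j"
    and "pmf (P (u + h) i) j \<le> (\<Sum>l\<in>A. pmf (P h i) l * pmf (P u l) j) + (1 - (\<Sum>l\<in>A. pmf (P h i) l))"
proof -
  have "P (h + u) i = bind_pmf (P h i) (P u)"
    using P i h u unfolding transition_semigroup_def by blast
  then have eq: "pmf (P (u + h) i) j = measure_pmf.expectation (P h i) (\<lambda>l. pmf (P u l) j)"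
    by (simp add: pmf_bind add.commute)
  show "(\<Sum>l\<in>A. pmf (P h i) l * pmf (P u l) j) \<le> pmf (P (u + h) i) j"
   "pmf (P (u + h) i) j \<le> (\<Sum>l\<in>A. pmf (P h i) l * pmf (P u l) j) + (1 - (\<Sum>l\<in>A. pmf (P h i) l))"
    unfolding eq using A by (intro pmf_integral_finite_approx; simp add: pmf_le_1)+
qed

text \<open>Truncating to {i} bounds the increment over a step \<open>h\<close> by the probability
  of being away from \<open>i\<close> at time \<open>h\<close>, uniformly in \<open>u\<close>. This
  tends to 0 because the exit rate is finite.\<close>

lemma continuous_on_transition:
  assumes P: "transition_semigroup S P" "has_transition_rates S P r" and i: "i \<in> S"
  shows "continuous_on {0..} (\<lambda>u. pmf (P u i) j)"
proof -
  have lip: "\<bar>pmf (P (u + h) i) j - pmf (P u i) j\<bar> \<le> 1 - pmf (P h i) i" if "0 \<le> h" "0 \<le> u" for u h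
  proof -
    have "0 \<le> (1 - pmf (P h i) i) * pmf (P u i) j"
      "(1 - pmf (P h i) i) * pmf (P u i) j \<le> (1 - pmf (P h i) i) * 1"
      by (intro mult_nonneg_nonneg mult_left_mono; simp add: pmf_le_1)+
    then show ?thesis
      using transition_semigroup_approx[OF P(1) i that, of "{i}" j] by (simp add: algebra_simps)
  qed
  have "((\<lambda>h. h * ((1 - pmf (P h i) i) / h)) \<longlongrightarrow> 0 * (\<Sum>\<^sub>\<infinity>j\<in>S - {i}. r i j)) (at_right 0)"
    using P(2) i unfolding has_transition_rates_def by (intro tendsto_mult tendsto_ident_at) auto
  moreover have "\<forall>\<^sub>F h in at_right 0. h * ((1 - pmf (P h i) i) / h) = 1 - pmf (P h i) i"
    by (auto simp: eventually_at_filter)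
  ultimately have "((\<lambda>h. 1 - pmf (P h i) i) \<longlongrightarrow> 0) (at_right 0)"
    by (auto dest: Lim_transform_eventually)
  then have ev: "\<forall>\<^sub>F h in at_right 0. 1 - pmf (P h i) i < e" if "0 < e" for e
    using that by (rule order_tendstoD)
  have P0: "pmf (P 0 i) i = 1"
    using P(1) i by (simp add: transition_semigroup_def)
  show ?thesis
    unfolding continuous_on_iff
  proof safe
    fix u e :: real assume u: "0 \<le> u" and e: "0 < e"
    from ev[OF e] obtain d where d: "d > 0" "\<And>h. 0 < h \<Longrightarrow> h < d \<Longrightarrow> 1 - pmf (P h i) i < e"
      by (auto simp: eventually_at_right_field)
    have d0: "1 - pmf (P h i) i < e" if "0 \<le> h" "h < d" for h
      using that d e P0 by (cases "h = 0") auto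
    show "\<exists>d>0. \<forall>v\<in>{0..}. dist v u < d \<longrightarrow> dist (pmf (P v i) j) (pmf (P u i) j) < e"
    proof (intro exI conjI ballI impI)
      fix v :: real assume v: "v \<in> {0..}" "dist v u < d"
      show "dist (pmf (P v i) j) (pmf (P u i) j) < e"
        \<comment> \<open>The bound \<open>lip\<close> runs forward in time, so it starts from the
          earlier of \<open>u\<close> and \<open>v\<close>.\<close>
        using lip[of "v - u" u] lip[of "u - v" v] d0[of "v - u"] d0[of "u - v"] u v
        by (cases "u \<le> v") (auto simp: dist_real_def abs_if split: if_splits)
    qed (fact d(1))
  qed
qed

lemma laplace_transform_bounds:
  fixes f :: "real \<Rightarrow> real"
  assumes s: "0 < s" and f: "continuous_on {0..} f" and f01: "\<And>t. 0 \<le> t \<Longrightarrow> a \<le> f t" "\<And>t. 0 \<le> t \<Longrightarrow> f t \<le> b"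
  shows "a / s \<le> laplace_transform f s" "laplace_transform f s \<le> b / s"
proof -
  have c: "laplace_transform (\<lambda>_. c) s = c / s" for c
  proof -
    have "laplace_transform (\<lambda>_. c) s = integral {0..} (\<lambda>t. exp (- s * t)) * c"
      using set_borel_integral_eq_integral(2)[OF exp_minus_set_integrable[OF s]]
      unfolding laplace_transform_def by simp
    then show ?thesis
      using has_integral_exp_minus_to_infinity[OF s, of 0] by (simp add: has_integral_iff)
  qed
  have B: "\<bar>f t\<bar> \<le> max \<bar>a\<bar> \<bar>b\<bar>" if "0 \<le> t" for t
    using f01[OF that] by linarith
  have int: "set_integrable lborel {0..} (\<lambda>t. exp (- s * t) * f t)"
    using s f B by (rule continuous_laplace_set_integrable)
  have int': "set_integrable lborel {0..} (\<lambda>t. exp (- s * t) * c)" for c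
    using exp_minus_set_integrable[OF s] by simp
  show "a / s \<le> laplace_transform f s"
    unfolding c[symmetric] unfolding laplace_transform_def using f01
    by (intro set_integral_mono int int' mult_left_mono) auto
  show "laplace_transform f s \<le> b / s"
    unfolding c[symmetric] unfolding laplace_transform_def using f01
    by (intro set_integral_mono int int' mult_left_mono) auto
qed

lemma laplace_transform_cmult: "laplace_transform (\<lambda>t. c * f t) s = c * laplace_transform f s"
  unfolding laplace_transform_def by (simp add: mult.left_commute)

lemma laplace_transform_diff:
  assumes "set_integrable lborel {0..} (\<lambda>t. exp (- s * t) * f t)" "set_integrable lborel {0..} (\<lambda>t. exp (- s * t) * g t)"
  shows "laplace_transform (\<lambda>t. f t - g t) s = laplace_transform f s - laplace_transform g s"
  unfolding laplace_transform_def using assms by (simp add: right_diff_distrib)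

lemma laplace_transform_sum:
  assumes "\<And>x. x \<in> A \<Longrightarrow> set_integrable lborel {0..} (\<lambda>t. exp (- s * t) * f x t)"
  shows "laplace_transform (\<lambda>t. \<Sum>x\<in>A. f x t) s = (\<Sum>x\<in>A. laplace_transform (f x) s)"
  using assms unfolding laplace_transform_def set_lebesgue_integral_def set_integrable_def
  by (simp add: sum_distrib_left)

text \<open>The Laplace transform of the backward equation. One difference quotient in
  \<open>h\<close> is evaluated twice: by shifting the integration variable, and by
  Chapman-Kolmogorov truncated to \<open>i\<close> and \<open>F\<close>. The mass discarded by the
  truncation is o(h), because the exit rate from \<open>i\<close> is the sum of the rates into
  \<open>F\<close>.\<close>

lemma resolvent_equation:
  assumes P: "transition_semigroup S P" "has_transition_rates S P r" and i: "i \<in> S" and s: "0 < s"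
    and F: "finite F" "F \<subseteq> S - {i}" "\<And>l. l \<in> S - {i} - F \<Longrightarrow> r i l = 0"
  shows "(s + sum (r i) F) * laplace_transform (\<lambda>t. pmf (P t i) j) s =
    of_bool (i = j) + (\<Sum>l\<in>F. r i l * laplace_transform (\<lambda>t. pmf (P t l) j) s)"
proof -
  define R where "R l = laplace_transform (\<lambda>t. pmf (P t l) j) s" for l
  define A where "A = insert i F"
  have A: "finite A" "A \<subseteq> S" using F i by (auto simp: A_def)
  have notin: "i \<notin> F" using F by auto
  have cont: "continuous_on {0..} (\<lambda>u. pmf (P u l) j)" if "l \<in> S" for l
    using that by (rule continuous_on_transition[OF P])
  have int: "set_integrable lborel {0..} (\<lambda>t. exp (- s * t) * f t)"
    if "continuous_on {0..} f" "\<And>t. 0 \<le> t \<Longrightarrow> \<bar>f t\<bar> \<le> 1" for f :: "real \<Rightarrow> real"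
    using s that by (rule continuous_laplace_set_integrable)
  have cont': "continuous_on {0..} (\<lambda>t. pmf (P (t + h) i) j)" if "0 \<le> h" for h
    by (rule continuous_on_compose2[OF cont[OF i]]) (use that in \<open>auto intro!: continuous_intros\<close>)
  \<comment> \<open>The contribution of the states outside \<open>A\<close> at time
    \<open>h\<close>.\<close>
  define err where "err h = laplace_transform (\<lambda>t. pmf (P (t + h) i) j) s - (\<Sum>l\<in>A. pmf (P h i) l * R l)" for h
  have err: "0 \<le> err h" "err h \<le> (1 - (\<Sum>l\<in>A. pmf (P h i) l)) / s" if h: "0 \<le> h" for h
  proof -
    have *: "err h = laplace_transform (\<lambda>t. pmf (P (t + h) i) j - (\<Sum>l\<in>A. pmf (P h i) l * pmf (P t l) j)) s"
    proof -
      have "set_integrable lborel {0..} (\<lambda>t. exp (- s * t) * (pmf (P h i) l * pmf (P t l) j))" if "l \<in> A" for l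
        using that A by (intro int continuous_intros cont) (auto simp: abs_mult pmf_le_1 intro!: mult_le_one)
      moreover from this have "set_integrable lborel {0..} (\<lambda>t. exp (- s * t) * (\<Sum>l\<in>A. pmf (P h i) l * pmf (P t l) j))"
        by (simp add: sum_distrib_left set_integrable_def)
      moreover have "set_integrable lborel {0..} (\<lambda>t. exp (- s * t) * pmf (P (t + h) i) j)"
        using h by (intro int cont') (auto simp: pmf_le_1)
      ultimately show ?thesis
        unfolding err_def R_def by (simp add: laplace_transform_diff laplace_transform_sum laplace_transform_cmult)
    qed
    have c: "continuous_on {0..} (\<lambda>t. pmf (P (t + h) i) j - (\<Sum>l\<in>A. pmf (P h i) l * pmf (P t l) j))"
      using A h by (intro continuous_intros cont' cont) auto
    have "0 / s \<le> err h"
      unfolding * using transition_semigroup_approx(1)[OF P(1) i h _ A(1), of _ j]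
        transition_semigroup_approx(2)[OF P(1) i h _ A(1), of _ j]
      by (intro laplace_transform_bounds(1)[OF s c, of 0 "1 - (\<Sum>l\<in>A. pmf (P h i) l)"])
        (simp_all add: algebra_simps)
    then show "0 \<le> err h" by simp
    show "err h \<le> (1 - (\<Sum>l\<in>A. pmf (P h i) l)) / s"
      unfolding * using transition_semigroup_approx(1)[OF P(1) i h _ A(1), of _ j]
        transition_semigroup_approx(2)[OF P(1) i h _ A(1), of _ j]
      by (intro laplace_transform_bounds(2)[OF s c, of 0 "1 - (\<Sum>l\<in>A. pmf (P h i) l)"])
        (simp_all add: algebra_simps)
  qed
  define q where "q = sum (r i) F"
  have "(\<Sum>\<^sub>\<infinity>l\<in>S - {i}. r i l) = (\<Sum>\<^sub>\<infinity>l\<in>F. r i l)"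
    using F by (intro infsum_cong_neutral) auto
  then have q: "((\<lambda>h. (1 - pmf (P h i) i) / h) \<longlongrightarrow> q) (at_right 0)"
    using P(2) i F(1) unfolding has_transition_rates_def q_def by auto
  have rates: "((\<lambda>h. pmf (P h i) l / h) \<longlongrightarrow> r i l) (at_right 0)" if "l \<in> F" for l
    using P(2) i F that unfolding has_transition_rates_def by blast
  \<comment> \<open>The mass lost at \<open>i\<close> and the mass gained on \<open>F\<close> have
    the same rate \<open>q\<close>, so the mass outside \<open>A\<close> is o(h).\<close>
  have "((\<lambda>h. ((1 - pmf (P h i) i) / h - (\<Sum>l\<in>F. pmf (P h i) l / h)) / s) \<longlongrightarrow> (q - (\<Sum>l\<in>F. r i l)) / s) (at_right 0)"
    by (intro tendsto_intros q rates) (use s in auto)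
  moreover have "((1 - pmf (P h i) i) / h - (\<Sum>l\<in>F. pmf (P h i) l / h)) / s =
      (1 - (\<Sum>l\<in>A. pmf (P h i) l)) / s / h" for h
    unfolding sum_divide_distrib[symmetric] A_def using F(1) notin s
    by (cases "h = 0") (simp_all add: field_simps)
  ultimately have lim0: "((\<lambda>h. (1 - (\<Sum>l\<in>A. pmf (P h i) l)) / s / h) \<longlongrightarrow> 0) (at_right 0)"
    by (simp add: q_def)
  have lim_err: "((\<lambda>h. err h / h) \<longlongrightarrow> 0) (at_right 0)"
  proof (rule tendsto_sandwich[OF _ _ tendsto_const lim0])
    show "\<forall>\<^sub>F h in at_right 0. 0 \<le> err h / h"
      using eventually_at_right_less[of "0::real"] by eventually_elim (simp add: err(1))
    show "\<forall>\<^sub>F h in at_right 0. err h / h \<le> (1 - (\<Sum>l\<in>A. pmf (P h i) l)) / s / h"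
      using eventually_at_right_less[of "0::real"]
      by eventually_elim (intro divide_right_mono err(2); simp)
  qed
  \<comment> \<open>The Chapman-Kolmogorov side of the difference quotient;
    \<open>laplace_transform_shift_deriv\<close> supplies the other one below.\<close>
  have "((\<lambda>h. - ((1 - pmf (P h i) i) / h) * R i + (\<Sum>l\<in>F. pmf (P h i) l / h * R l) + err h / h)
      \<longlongrightarrow> - q * R i + (\<Sum>l\<in>F. r i l * R l) + 0) (at_right 0)"
    by (intro tendsto_intros q rates lim_err)
  moreover have "- ((1 - pmf (P h i) i) / h) * R i + (\<Sum>l\<in>F. pmf (P h i) l / h * R l) + err h / h =
      (laplace_transform (\<lambda>t. pmf (P (t + h) i) j) s - R i) / h" for h
    using F(1) notin by (simp add: err_def A_def algebra_simps add_divide_distrib diff_divide_distrib sum_divide_distrib)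
  ultimately have "((\<lambda>h. (laplace_transform (\<lambda>t. pmf (P (t + h) i) j) s - R i) / h)
      \<longlongrightarrow> - q * R i + (\<Sum>l\<in>F. r i l * R l)) (at_right 0)"
    by simp
  moreover have "((\<lambda>h. (laplace_transform (\<lambda>t. pmf (P (t + h) i) j) s - R i) / h)
      \<longlongrightarrow> s * R i - pmf (P 0 i) j) (at_right 0)"
    unfolding R_def using cont[OF i] by (intro laplace_transform_shift_deriv[OF s, where B=1]) (auto simp: pmf_le_1)
  ultimately have "- q * R i + (\<Sum>l\<in>F. r i l * R l) = s * R i - pmf (P 0 i) j"
    by (rule tendsto_unique[rotated]) simp
  moreover have "pmf (P 0 i) j = of_bool (i = j)"
    using P(1) i by (auto simp: transition_semigroup_def pmf_return indicator_def)
  ultimately show ?thesis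
    by (simp add: R_def q_def algebra_simps)
qed

section \<open>First passage times of a subordinator at an exponential time\<close>

lemma inverse_process_nonneg: "0 \<le> inverse_process D t \<omega>"
  unfolding inverse_process_def by (auto intro: cInf_greatest)

lemma inverse_process_le:
  assumes "0 \<le> u" "t < D u \<omega>"
  shows "inverse_process D t \<omega> \<le> u"
proof -
  have "bdd_below {s. 0 \<le> s \<and> t < D s \<omega>}" by (auto intro: bdd_belowI[of _ 0])
  then show ?thesis
    using assms unfolding inverse_process_def by (auto intro: cInf_lower)
qed

lemma inverse_process_eq_Inf:
  assumes "0 \<le> v" "t < D v \<omega>" "0 < t"
  shows "inverse_process D t \<omega> = Inf {s. 0 \<le> s \<and> t < D s \<omega>}"
  using assms unfolding inverse_process_def by auto

text \<open>An infimum below \<open>u\<close> has a member of the set below \<open>u\<close>, and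
  the path is monotone. The witness \<open>v\<close> and \<open>0 < t\<close> exclude the default
  value 0, for which no such member need exist.\<close>

lemma less_of_inverse_process_less:
  assumes mono: "\<And>s t. 0 \<le> s \<Longrightarrow> s \<le> t \<Longrightarrow> D s \<omega> \<le> D t \<omega>"
    and unbdd: "0 \<le> v" "t < D v \<omega>" and t: "0 < t" and less: "inverse_process D t \<omega> < u"
  shows "t < D u \<omega>"
proof -
  have ne: "{s. 0 \<le> s \<and> t < D s \<omega>} \<noteq> {}" using unbdd by auto
  then have "Inf {s. 0 \<le> s \<and> t < D s \<omega>} < u"
    using less t unbdd by (simp add: inverse_process_eq_Inf)
  then obtain s where "0 \<le> s" "t < D s \<omega>" "s < u"
    using cInf_lessD[OF ne] by auto
  then show ?thesis using mono[of s u] by simp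
qed

text \<open>A higher level is exceeded at fewer times, which raises the infimum; \<open>v\<close>
  excludes the default value 0 at the higher level.\<close>

lemma inverse_process_mono:
  assumes "0 \<le> t" "t \<le> t'" and unbdd: "0 \<le> v" "t' < D v \<omega>"
  shows "inverse_process D t \<omega> \<le> inverse_process D t' \<omega>"
proof (cases "t = 0")
  case True
  then show ?thesis using inverse_process_nonneg[of D t' \<omega>] by (simp add: inverse_process_def)
next
  case False
  then have "inverse_process D t \<omega> \<le> s" if "0 \<le> s" "t' < D s \<omega>" for s
    using that assms by (intro inverse_process_le) auto
  moreover have "{s. 0 \<le> s \<and> t' < D s \<omega>} \<noteq> {}" using unbdd by auto
  moreover have "inverse_process D t' \<omega> = Inf {s. 0 \<le> s \<and> t' < D s \<omega>}"
    using False assms by (intro inverse_process_eq_Inf[of v]) auto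
  ultimately show ?thesis by (auto intro: cInf_greatest)
qed

lemma integral_exponential_density:
  fixes g :: "real \<Rightarrow> real"
  assumes s: "0 < s" and g[measurable]: "g \<in> borel_measurable borel"
  shows "integral\<^sup>L (density lborel (exponential_density s)) g = s * laplace_transform g s"
proof -
  have "integral\<^sup>L (density lborel (exponential_density s)) g = (LINT t|lborel. exponential_density s t *\<^sub>R g t)"
    using s by (intro integral_density) (auto simp: erlang_density_def)
  also have "\<dots> = (LINT t|lborel. s * (indicator {0..} t *\<^sub>R (exp (- s * t) * g t)))"
    by (intro Bochner_Integration.integral_cong) (auto simp: exponential_density_def mult.commute)
  finally show ?thesis
    by (simp add: laplace_transform_def set_lebesgue_integral_def)
qed

text \<open>At level 0 the first passage time is 0 by convention, so it is compared with
  \<open>D\<close> at positive levels only.\<close>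

lemma AE_exponential_pos: "AE t in density lborel (exponential_density s). 0 < t"
proof -
  have "AE t in lborel. 0 < ennreal (exponential_density s t) \<longrightarrow> 0 < t"
    using AE_lborel_singleton[of 0] by eventually_elim (auto simp: exponential_density_def)
  then show ?thesis
    by (subst AE_density) auto
qed

lemma measure_exponential_less:
  assumes s: "0 < s" and a: "0 \<le> a"
  shows "measure (density lborel (exponential_density s)) {..<a} = 1 - exp (- s * a)"
proof -
  interpret N: prob_space "density lborel (exponential_density s)"
    using s by (rule prob_space_exponential_density)
  have "AE t in density lborel (exponential_density s). t \<noteq> a"
    using AE_lborel_singleton[of a] by (subst AE_density) (auto elim!: eventually_mono)
  then have "measure (density lborel (exponential_density s)) {..<a} =
      measure (density lborel (exponential_density s)) {..a}"
    by (intro N.finite_measure_eq_AE) (auto elim!: eventually_mono)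
  also have "\<dots> = 1 - exp (- s * a)"
    using emeasure_erlang_density[OF s, of 0 a] a s
    by (simp add: measure_def erlang_CDF_0)
  finally show ?thesis .
qed

lemma real_distribution_exponential:
  "0 < s \<Longrightarrow> real_distribution (density lborel (exponential_density s))"
  by (simp add: real_distribution_def real_distribution_axioms_def prob_space_exponential_density)

lemma cdf_exponential:
  assumes s: "0 < s"
  shows "cdf (density lborel (exponential_density s)) u = (if 0 \<le> u then 1 - exp (- s * u) else 0)"
  using emeasure_erlang_density[OF s, of 0 u] s
  by (auto simp: cdf_def measure_def erlang_CDF_0)

context prob_space
begin

section \<open>Nondecreasing processes with a prescribed Laplace exponent\<close>

context
  fixes D :: "real \<Rightarrow> 'a \<Rightarrow> real" and \<phi> :: "real \<Rightarrow> real"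
  assumes D_rv: "\<And>t. 0 \<le> t \<Longrightarrow> random_variable borel (D t)"
    and D_0: "AE \<omega> in M. D 0 \<omega> = 0"
    and D_mono: "AE \<omega> in M. \<forall>s\<ge>0. \<forall>t\<ge>s. D s \<omega> \<le> D t \<omega>"
    and D_laplace: "\<And>t z. 0 \<le> t \<Longrightarrow> 0 < z \<Longrightarrow> expectation (\<lambda>\<omega>. exp (- z * D t \<omega>)) = exp (- t * \<phi> z)"
    and \<phi>_pos: "\<And>z. 0 < z \<Longrightarrow> 0 < \<phi> z"
    and Y_rv: "\<And>t. 0 \<le> t \<Longrightarrow> random_variable borel (inverse_process D t)"
begin

lemma subordinator_nonneg: "0 \<le> t \<Longrightarrow> AE \<omega> in M. 0 \<le> D t \<omega>"
  using D_0 D_mono by eventually_elim auto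

text \<open>A non-integrable function has Bochner integral 0, whereas the prescribed value is an
  exponential and hence positive.\<close>

lemma integrable_exp_subordinator: "0 \<le> t \<Longrightarrow> 0 < z \<Longrightarrow> integrable M (\<lambda>\<omega>. exp (- z * D t \<omega>))"
  using D_laplace[of t z] not_integrable_integral_eq[of M "\<lambda>\<omega>. exp (- z * D t \<omega>)"] by fastforce

text \<open>A Chernoff bound: D(n) \<le> m has probability at most exp (m - n * \<phi> 1), which
  tends to 0 as n grows.\<close>

lemma subordinator_unbounded: "AE \<omega> in M. \<forall>t. \<exists>u\<ge>0. t < D u \<omega>"
proof -
  have "AE \<omega> in M. \<exists>u\<ge>0. real m < D u \<omega>" for m
  proof -
    \<comment> \<open>Integer times keep the event a countable intersection.\<close>
    define B where "B = {\<omega> \<in> space M. \<forall>n. D (real n) \<omega> \<le> real m}"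
    note [measurable] = D_rv[OF of_nat_0_le_iff]
    have [measurable]: "B \<in> events" unfolding B_def by measurable
    have le: "prob B \<le> exp (real m) * exp (- real n * \<phi> 1)" for n
    proof -
      have "prob B = expectation (indicator B)" by simp
      also have "\<dots> \<le> expectation (\<lambda>\<omega>. exp (real m) * exp (- 1 * D (real n) \<omega>))"
      proof (rule integral_mono)
        show "integrable M (indicator B :: 'a \<Rightarrow> real)"
          by (intro integrable_const_bound[where B=1]) auto
        show "integrable M (\<lambda>\<omega>. exp (real m) * exp (- 1 * D (real n) \<omega>))"
          by (intro integrable_mult_right integrable_exp_subordinator) auto
      qed (auto simp: indicator_def B_def simp flip: exp_add)
      also have "\<dots> = exp (real m) * exp (- real n * \<phi> 1)"
        using D_laplace[of "real n" 1] by simp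
      finally show ?thesis .
    qed
    have lim: "(\<lambda>n. exp (real m) * exp (- real n * \<phi> 1)) \<longlonglongrightarrow> exp (real m) * 0"
    proof -
      have "(\<lambda>n. exp (- \<phi> 1) ^ n) \<longlonglongrightarrow> 0"
        using \<phi>_pos[of 1] by (intro LIMSEQ_realpow_zero) auto
      then show ?thesis
        by (intro tendsto_mult tendsto_const) (simp add: exp_of_nat_mult flip: exp_of_nat_mult)
    qed
    have "prob B \<le> exp (real m) * 0"
      using LIMSEQ_le_const[OF lim] le by blast
    then have "prob B = 0" by (simp add: measure_le_0_iff)
    then have "AE \<omega> in M. \<omega> \<notin> B"
      by (intro AE_not_in) (auto simp: null_sets_def emeasure_eq_measure)
    then show ?thesis
      using AE_space
    proof eventually_elim
      case (elim \<omega>)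
      then obtain n where "real m < D (real n) \<omega>" by (auto simp: B_def not_le)
      then show ?case by (intro exI[of _ "real n"]) simp
    qed
  qed
  then have "AE \<omega> in M. \<forall>m::nat. \<exists>u\<ge>0. real m < D u \<omega>"
    by (simp add: AE_all_countable)
  then show ?thesis
  proof eventually_elim
    case (elim \<omega>)
    show ?case
    proof
      fix t :: real
      obtain m :: nat where "t < real m" using reals_Archimedean2 by blast
      then show "\<exists>u\<ge>0. t < D u \<omega>" using elim by (meson less_trans)
    qed
  qed
qed

text \<open>The first inclusion of events holds on every path, the second on nondecreasing paths
  that exceed the level \<open>t\<close>, hence almost surely.\<close>

lemma prob_inverse_process:
  assumes t: "0 < t" and u: "0 \<le> u"
  shows "prob {\<omega> \<in> space M. t < D u \<omega>} \<le> prob {\<omega> \<in> space M. inverse_process D t \<omega> \<le> u}"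
    and "prob {\<omega> \<in> space M. inverse_process D t \<omega> < u} \<le> prob {\<omega> \<in> space M. t < D u \<omega>}"
proof -
  note [measurable] = D_rv[OF u] Y_rv[OF less_imp_le[OF t]]
  show "prob {\<omega> \<in> space M. t < D u \<omega>} \<le> prob {\<omega> \<in> space M. inverse_process D t \<omega> \<le> u}"
    using u by (intro finite_measure_mono) (auto intro: inverse_process_le)
  have "AE \<omega> in M. inverse_process D t \<omega> < u \<longrightarrow> t < D u \<omega>"
    using D_mono subordinator_unbounded
  proof eventually_elim
    case (elim \<omega>)
    then obtain v where "0 \<le> v" "t < D v \<omega>" by blast
    then show ?case using elim t by (blast intro: less_of_inverse_process_less)
  qed
  then show "prob {\<omega> \<in> space M. inverse_process D t \<omega> < u} \<le> prob {\<omega> \<in> space M. t < D u \<omega>}"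
    by (intro finite_measure_mono_AE) auto
qed

text \<open>The inverse process is only known to be measurable at nonnegative times.\<close>

definition inverse_kernel :: "real \<Rightarrow> real measure" where
  "inverse_kernel t = distr M borel (inverse_process D (max 0 t))"

lemma measure_inverse_kernel:
  "0 \<le> t \<Longrightarrow> B \<in> sets borel \<Longrightarrow> measure (inverse_kernel t) B = prob {\<omega> \<in> space M. inverse_process D t \<omega> \<in> B}"
  unfolding inverse_kernel_def by (subst measure_distr) (auto simp: Y_rv max_def intro!: arg_cong[where f=prob])

lemma prob_space_inverse_kernel: "prob_space (inverse_kernel t)"
  unfolding inverse_kernel_def by (intro prob_space_distr Y_rv) simp

text \<open>Almost surely the first passage time is nondecreasing in the level, so the mass of a
  half-line is a monotone and hence Borel function of \<open>t\<close>. Half-lines are a generator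
  stable under intersection.\<close>

lemma measurable_inverse_kernel: "inverse_kernel \<in> borel \<rightarrow>\<^sub>M prob_algebra borel"
proof (rule measurable_prob_algebra_generated)
  interpret K: prob_space "inverse_kernel t" for t by (rule prob_space_inverse_kernel)
  show "sets (borel :: real measure) = sigma_sets UNIV (range atMost)"
    by (subst borel_eq_atMost) simp
  show "Int_stable (range (atMost :: real \<Rightarrow> _))"
    by (auto simp: Int_stable_def min_def)
  fix A :: "real set" assume "A \<in> range atMost"
  then obtain a where A: "A = {..a}" by auto
  have "mono (\<lambda>t. - measure (inverse_kernel t) A)"
  proof (rule monoI)
    fix t t' :: real assume le: "t \<le> t'"
    note [measurable] = Y_rv[of "max 0 t"] Y_rv[of "max 0 t'"]
    have "AE \<omega> in M. inverse_process D (max 0 t) \<omega> \<le> inverse_process D (max 0 t') \<omega>"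
      using subordinator_unbounded
    proof eventually_elim
      case (elim \<omega>)
      then obtain v where "0 \<le> v" "max 0 t' < D v \<omega>" by blast
      then show ?case using le by (intro inverse_process_mono) auto
    qed
    then have "prob {\<omega> \<in> space M. inverse_process D (max 0 t') \<omega> \<le> a} \<le> prob {\<omega> \<in> space M. inverse_process D (max 0 t) \<omega> \<le> a}"
      by (intro finite_measure_mono_AE) (auto elim!: eventually_mono)
    then show "- measure (inverse_kernel t) A \<le> - measure (inverse_kernel t') A"
      unfolding A inverse_kernel_def
      by (simp add: measure_distr Y_rv vimage_def Int_def conj_commute)
  qed
  then have "(\<lambda>t. - (- measure (inverse_kernel t) A)) \<in> borel_measurable borel"
    by (intro borel_measurable_uminus borel_measurable_mono)
  then show "(\<lambda>t. emeasure (inverse_kernel t) A) \<in> borel_measurable borel"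
    by (simp add: K.emeasure_eq_measure)
next
  show "sets (inverse_kernel t) = sets borel" for t
    by (simp add: inverse_kernel_def)
qed (auto simp: prob_space_inverse_kernel)

lemmas measurable_inverse_kernel_subprob = measurable_prob_algebraD[OF measurable_inverse_kernel]

text \<open>Fubini on the product with the exponential law: integrating out the exponential time
  first leaves the expectation of 1 - exp (- z * D u).\<close>

lemma expectation_exponential_less_subordinator:
  assumes z: "0 < z" and u: "0 \<le> u"
  shows "integral\<^sup>L (density lborel (exponential_density z)) (\<lambda>t. prob {\<omega> \<in> space M. t < D u \<omega>}) = 1 - exp (- u * \<phi> z)"
    and "integrable (density lborel (exponential_density z)) (\<lambda>t. prob {\<omega> \<in> space M. t < D u \<omega>})"
proof -
  let ?N = "density lborel (exponential_density z)"
  interpret N: prob_space ?N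
    using z by (rule prob_space_exponential_density)
  interpret MN: pair_prob_space M ?N ..
  note [measurable] = D_rv[OF u]
  let ?f = "\<lambda>\<omega> t. indicator {..<D u \<omega>} t :: real"
  have [measurable]: "case_prod ?f \<in> borel_measurable (M \<Otimes>\<^sub>M ?N)"
    unfolding indicator_def lessThan_iff by measurable
  have int: "integrable (M \<Otimes>\<^sub>M ?N) (case_prod ?f)"
    by (intro MN.P.integrable_const_bound[where B=1]) auto
  have eq: "(\<integral>\<omega>. ?f \<omega> t \<partial>M) = prob {\<omega> \<in> space M. t < D u \<omega>}" for t
  proof -
    have "(\<integral>\<omega>. ?f \<omega> t \<partial>M) = (\<integral>\<omega>. indicator {\<omega> \<in> space M. t < D u \<omega>} \<omega> \<partial>M)"
      by (intro Bochner_Integration.integral_cong) (auto simp: indicator_def)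
    then show ?thesis by simp
  qed
  have "(\<integral>t. \<integral>\<omega>. ?f \<omega> t \<partial>M \<partial>?N) = (\<integral>\<omega>. \<integral>t. ?f \<omega> t \<partial>?N \<partial>M)"
    using int by (rule MN.Fubini_integral)
  also have "\<dots> = (\<integral>\<omega>. 1 - exp (- z * D u \<omega>) \<partial>M)"
  proof (rule integral_cong_AE)
    \<comment> \<open>The exponential distribution function has this form only at nonnegative
      arguments.\<close>
    show "AE \<omega> in M. (\<integral>t. ?f \<omega> t \<partial>?N) = 1 - exp (- z * D u \<omega>)"
      using subordinator_nonneg[OF u] by eventually_elim (use z in \<open>simp add: measure_exponential_less\<close>)
  qed measurable
  also have "\<dots> = 1 - exp (- u * \<phi> z)"
    using integrable_exp_subordinator[OF u z] D_laplace[OF u z] by (simp add: prob_space)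
  finally show "integral\<^sup>L ?N (\<lambda>t. prob {\<omega> \<in> space M. t < D u \<omega>}) = 1 - exp (- u * \<phi> z)"
    by (simp only: eq)
  show "integrable ?N (\<lambda>t. prob {\<omega> \<in> space M. t < D u \<omega>})"
    using MN.integrable_snd[OF int] by (simp only: eq)
qed

text \<open>The left side is the law of the first passage time at an independent exponential level.
  Integrating \<open>prob_inverse_process\<close> bounds it from below on closed half-lines and from
  above on open ones; continuity of the target distribution function closes the gap.\<close>

lemma exponential_bind_inverse_kernel:
  assumes z: "0 < z"
  shows "density lborel (exponential_density z) \<bind> inverse_kernel = density lborel (exponential_density (\<phi> z))"
proof -
  let ?N = "density lborel (exponential_density z)"
  interpret N: prob_space ?N
    using z by (rule prob_space_exponential_density)
  interpret K: prob_space "inverse_kernel t" for t by (rule prob_space_inverse_kernel)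
  have K[measurable]: "inverse_kernel \<in> ?N \<rightarrow>\<^sub>M subprob_algebra borel"
    using measurable_inverse_kernel_subprob by simp
  define \<nu> where "\<nu> = ?N \<bind> inverse_kernel"
  have "prob_space \<nu>"
    unfolding \<nu>_def by (rule N.prob_space_bind[OF _ K]) (simp add: prob_space_inverse_kernel)
  moreover have sets_\<nu>: "sets \<nu> = sets borel"
    unfolding \<nu>_def by (rule sets_bind) (auto simp: inverse_kernel_def)
  ultimately interpret \<nu>: real_distribution \<nu>
    by (simp add: real_distribution_def real_distribution_axioms_def)
  have \<nu>_eq: "measure \<nu> B = (\<integral>t. measure (inverse_kernel t) B \<partial>?N)" if "B \<in> sets borel" for B
    unfolding \<nu>_def by (rule N.measure_bind[OF K that])
  have int: "integrable ?N (\<lambda>t. measure (inverse_kernel t) B)" if B: "B \<in> sets borel" for B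
    using B by (intro N.integrable_const_bound[where B=1]) auto
  have lower: "1 - exp (- u * \<phi> z) \<le> cdf \<nu> u" if u: "0 \<le> u" for u
    unfolding cdf_def expectation_exponential_less_subordinator(1)[OF z u, symmetric] \<nu>_eq[OF atMost_borel]
  proof (rule integral_mono_AE)
    show "AE t in ?N. prob {\<omega> \<in> space M. t < D u \<omega>} \<le> measure (inverse_kernel t) {..u}"
      using AE_exponential_pos[of z]
      by eventually_elim (use prob_inverse_process(1) u in \<open>simp add: measure_inverse_kernel\<close>)
  qed (auto intro: int expectation_exponential_less_subordinator(2) z u)
  have upper: "measure \<nu> {..<u} \<le> 1 - exp (- u * \<phi> z)" if u: "0 \<le> u" for u
    unfolding expectation_exponential_less_subordinator(1)[OF z u, symmetric] \<nu>_eq[OF lessThan_borel]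
  proof (rule integral_mono_AE)
    show "AE t in ?N. measure (inverse_kernel t) {..<u} \<le> prob {\<omega> \<in> space M. t < D u \<omega>}"
      using AE_exponential_pos[of z]
      by eventually_elim (use prob_inverse_process(2) u in \<open>simp add: measure_inverse_kernel\<close>)
  qed (auto intro: int expectation_exponential_less_subordinator(2) z u)
  have "cdf \<nu> u = cdf (density lborel (exponential_density (\<phi> z))) u" for u
  proof (cases "0 \<le> u")
    case u: True
    \<comment> \<open>The closed half-line at \<open>u\<close> lies in open ones slightly further
      right, to which \<open>upper\<close> applies.\<close>
    have "cdf \<nu> u \<le> 1 - exp (- (u + 1 / real (Suc n)) * \<phi> z)" for n
    proof -
      have "cdf \<nu> u \<le> measure \<nu> {..<u + 1 / real (Suc n)}"
        unfolding cdf_def by (intro \<nu>.finite_measure_mono) (auto simp: less_add_same_cancel1 intro: le_less_trans)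
      also have "\<dots> \<le> 1 - exp (- (u + 1 / real (Suc n)) * \<phi> z)"
        using u by (intro upper) simp
      finally show ?thesis .
    qed
    moreover have "(\<lambda>n. 1 - exp (- (u + 1 / real (Suc n)) * \<phi> z)) \<longlonglongrightarrow> 1 - exp (- (u + 0) * \<phi> z)"
      by (intro tendsto_intros LIMSEQ_Suc[OF lim_1_over_n])
    ultimately have "cdf \<nu> u \<le> 1 - exp (- (u + 0) * \<phi> z)"
      by (intro LIMSEQ_le_const) auto
    then show ?thesis
      using lower[OF u] u by (simp add: cdf_exponential \<phi>_pos[OF z] mult.commute)
  next
    case False
    \<comment> \<open>At \<open>u = 0\<close> the bound \<open>upper\<close> leaves no mass on the
      negative half-line.\<close>
    then have "cdf \<nu> u \<le> measure \<nu> {..<0}"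
      unfolding cdf_def by (intro \<nu>.finite_measure_mono) auto
    also have "\<dots> \<le> 0" using upper[of 0] by simp
    finally show ?thesis
      using False measure_nonneg[of \<nu> "{..u}"] by (simp add: cdf_exponential \<phi>_pos[OF z] cdf_def[of \<nu>])
  qed
  then show ?thesis
    unfolding \<nu>_def[symmetric]
    by (intro cdf_unique \<nu>.real_distribution_axioms real_distribution_exponential \<phi>_pos[OF z]) auto
qed

text \<open>Up to the factor \<open>z\<close>, the transform of \<open>G\<close> is the mean of
  \<open>G\<close> at an exponential time of rate \<open>z\<close>, that is, the mean of
  \<open>g\<close> at one of rate \<open>\<phi> z\<close>. Reading this back as a transform gives
  the quotient of the two rates.\<close>

lemma laplace_transform_inverse_process:
  fixes g :: "real \<Rightarrow> real"
  assumes z: "0 < z" and g: "continuous_on {0..} g" and B: "\<And>t. 0 \<le> t \<Longrightarrow> \<bar>g t\<bar> \<le> B"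
  defines "G \<equiv> \<lambda>t. expectation (\<lambda>\<omega>. g (inverse_process D t \<omega>))"
  shows "set_borel_measurable lborel {0..} G"
    and "laplace_transform G z = \<phi> z / z * laplace_transform g (\<phi> z)"
proof -
  let ?N = "density lborel (exponential_density z)"
  interpret N: prob_space ?N
    using z by (rule prob_space_exponential_density)
  have K[measurable]: "inverse_kernel \<in> borel \<rightarrow>\<^sub>M subprob_algebra borel"
    by (rule measurable_inverse_kernel_subprob)
  \<comment> \<open>Constant extension to the left makes \<open>g\<close> continuous, hence Borel,
    on the whole line; passage times are nonnegative, so no value in use changes.\<close>
  define g' where "g' u = g (max 0 u)" for u
  have "continuous_on UNIV g'"
    unfolding g'_def by (rule continuous_on_compose2[OF g]) (auto intro!: continuous_intros)
  then have g'[measurable]: "g' \<in> borel_measurable borel"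
    by (rule borel_measurable_continuous_onI)
  have G_eq: "G t = integral\<^sup>L (inverse_kernel t) g'" if "0 \<le> t" for t
    using that unfolding G_def inverse_kernel_def
    by (subst integral_distr) (auto simp: Y_rv g'_def max_def inverse_process_nonneg intro!: Bochner_Integration.integral_cong)
  have GK: "(\<lambda>t. integral\<^sup>L (inverse_kernel t) g') \<in> borel_measurable borel"
    by measurable
  have lcong: "laplace_transform f s = laplace_transform f' s" if "\<And>t. 0 \<le> t \<Longrightarrow> f t = f' t" for f f' s
    unfolding laplace_transform_def using that by (intro set_lebesgue_integral_cong) auto
  show "set_borel_measurable lborel {0..} G"
  proof -
    have "(\<lambda>t. indicator {0..} t *\<^sub>R integral\<^sup>L (inverse_kernel t) g') \<in> borel_measurable lborel"
      using GK by (intro borel_measurable_scaleR) auto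
    also have "(\<lambda>t. indicator {0..} t *\<^sub>R integral\<^sup>L (inverse_kernel t) g') = (\<lambda>t. indicator {0..} t *\<^sub>R G t)"
      using G_eq by (auto simp: indicator_def)
    finally show ?thesis unfolding set_borel_measurable_def .
  qed
  have "z * laplace_transform G z = z * laplace_transform (\<lambda>t. integral\<^sup>L (inverse_kernel t) g') z"
    using G_eq by (auto intro!: lcong)
  also have "\<dots> = (\<integral>t. integral\<^sup>L (inverse_kernel t) g' \<partial>?N)"
    using z GK by (rule integral_exponential_density[symmetric])
  also have "\<dots> = integral\<^sup>L (?N \<bind> inverse_kernel) g'"
    using B by (intro integral_bind[symmetric, where K=borel and B'=1 and B=B])
      (auto simp: g'_def N.finite_measure_axioms intro!: AE_I2 prob_space.emeasure_le_1 prob_space_inverse_kernel)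
  also have "\<dots> = \<phi> z * laplace_transform g' (\<phi> z)"
    unfolding exponential_bind_inverse_kernel[OF z] using \<phi>_pos[OF z] g' by (rule integral_exponential_density)
  also have "laplace_transform g' (\<phi> z) = laplace_transform g (\<phi> z)"
    by (rule lcong) (simp add: g'_def)
  finally show "laplace_transform G z = \<phi> z / z * laplace_transform g (\<phi> z)"
    using z by (simp add: field_simps)
qed

end

end

section \<open>Processes evaluated at an independent time\<close>

text \<open>On each grid cell \<open>X\<close> is read at a deterministic time, where independence
  of single times applies. As the grid is refined, right-continuity in the discrete topology makes
  the indicators eventually constant; the limit event inherits measurability, and dominated
  convergence treats both sides.\<close>

lemma (in prob_space) prob_at_independent_time:
  fixes X :: "real \<Rightarrow> 'a \<Rightarrow> 's" and Y :: "'a \<Rightarrow> real"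
  assumes X: "\<And>u. 0 \<le> u \<Longrightarrow> {\<omega> \<in> space M. X u \<omega> = x} \<in> events"
    and rc: "\<And>\<omega> t. \<omega> \<in> space M \<Longrightarrow> 0 \<le> t \<Longrightarrow> \<forall>\<^sub>F s in at_right t. X s \<omega> = X t \<omega>"
    and Y[measurable]: "random_variable borel Y" and Y0: "\<And>\<omega>. \<omega> \<in> space M \<Longrightarrow> 0 \<le> Y \<omega>"
    and indep: "\<And>u B. 0 \<le> u \<Longrightarrow> B \<in> sets borel \<Longrightarrow>
      prob ({\<omega> \<in> space M. X u \<omega> = x} \<inter> {\<omega> \<in> space M. Y \<omega> \<in> B}) =
      prob {\<omega> \<in> space M. X u \<omega> = x} * prob {\<omega> \<in> space M. Y \<omega> \<in> B}"
    and p: "\<And>u. 0 \<le> u \<Longrightarrow> p u = prob {\<omega> \<in> space M. X u \<omega> = x}"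
    and cont: "continuous_on {0..} p"
  shows "{\<omega> \<in> space M. X (Y \<omega>) \<omega> = x} \<in> events"
    and "prob {\<omega> \<in> space M. X (Y \<omega>) \<omega> = x} = expectation (\<lambda>\<omega>. p (Y \<omega>))"
proof -
  define J where "J n \<omega> = nat \<lfloor>real (Suc n) * Y \<omega>\<rfloor>" for n \<omega>
  \<comment> \<open>The \<open>+ 1\<close> places the grid time strictly to the right of
    \<open>Y \<omega>\<close>, at distance at most 1 / (n + 1); \<open>at_right\<close> excludes the
    point itself.\<close>
  define \<tau> where "\<tau> n j = (real j + 1) / real (Suc n)" for n j :: nat
  define E where "E n = {\<omega> \<in> space M. X (\<tau> n (J n \<omega>)) \<omega> = x}" for n
  define E' where "E' = {\<omega> \<in> space M. X (Y \<omega>) \<omega> = x}"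
  have J[measurable]: "J n \<in> measurable M (count_space UNIV)" for n
    unfolding J_def by measurable
  have \<tau>0: "0 \<le> \<tau> n j" for n j by (simp add: \<tau>_def)
  have p01: "0 \<le> p u" "p u \<le> 1" if "0 \<le> u" for u
    using that by (simp_all add: p)
  let ?C = "\<lambda>n j. {\<omega> \<in> space M. X (\<tau> n j) \<omega> = x} \<inter> {\<omega> \<in> space M. J n \<omega> = j}"
  have C: "?C n j \<in> events" for n j
    using X[OF \<tau>0] by (intro sets.Int) auto
  have E_eq: "E n = (\<Union>j. ?C n j)" for n
    by (auto simp: E_def)
  have E[measurable]: "E n \<in> events" for n
    unfolding E_eq using C by (intro sets.countable_UN) auto
  have prob_E: "prob (E n) = expectation (\<lambda>\<omega>. p (\<tau> n (J n \<omega>)))" for n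
  proof -
    have "emeasure M (E n) = (\<Sum>j. emeasure M (?C n j))"
      unfolding E_eq using C by (intro suminf_emeasure[symmetric]) (auto simp: disjoint_family_on_def)
    also have "\<dots> = (\<Sum>j. ennreal (p (\<tau> n j)) * emeasure M {\<omega> \<in> space M. J n \<omega> = j})"
    proof (intro suminf_cong)
      fix j
      have "{\<omega> \<in> space M. J n \<omega> = j} = {\<omega> \<in> space M. Y \<omega> \<in> {y. nat \<lfloor>real (Suc n) * y\<rfloor> = j}}"
        by (simp add: J_def)
      then have "prob (?C n j) = p (\<tau> n j) * prob {\<omega> \<in> space M. J n \<omega> = j}"
        using indep[OF \<tau>0, of "{y. nat \<lfloor>real (Suc n) * y\<rfloor> = j}" n j] p[OF \<tau>0, of n j] by simp
      then show "emeasure M (?C n j) = ennreal (p (\<tau> n j)) * emeasure M {\<omega> \<in> space M. J n \<omega> = j}"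
        using p01[OF \<tau>0, of n j] by (simp add: emeasure_eq_measure ennreal_mult)
    qed
    also have "\<dots> = (\<integral>\<^sup>+\<omega>. (\<Sum>j. ennreal (p (\<tau> n j)) * indicator {\<omega> \<in> space M. J n \<omega> = j} \<omega>) \<partial>M)"
      by (subst nn_integral_suminf) (auto simp: nn_integral_cmult_indicator)
    also have "\<dots> = (\<integral>\<^sup>+\<omega>. ennreal (p (\<tau> n (J n \<omega>))) \<partial>M)"
      by (intro nn_integral_cong suminf_cmult_indicator) (auto simp: disjoint_family_on_def)
    also have "\<dots> = ennreal (expectation (\<lambda>\<omega>. p (\<tau> n (J n \<omega>))))"
      using p01[OF \<tau>0] by (intro nn_integral_eq_integral integrable_const_bound[where B=1])
        (auto intro: measurable_compose[OF J])
    finally show ?thesis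
      using p01[OF \<tau>0] by (simp add: emeasure_eq_measure integral_nonneg)
  qed
  have \<tau>_lim: "filterlim (\<lambda>n. \<tau> n (J n \<omega>)) (at_right (Y \<omega>)) sequentially" if \<omega>: "\<omega> \<in> space M" for \<omega>
  proof -
    have J_eq: "real (J n \<omega>) = of_int \<lfloor>real (Suc n) * Y \<omega>\<rfloor>" for n
      using Y0[OF \<omega>] unfolding J_def by (intro of_nat_nat) simp
    have gt: "Y \<omega> < \<tau> n (J n \<omega>)" for n
      using floor_correct[of "real (Suc n) * Y \<omega>"] unfolding \<tau>_def J_eq
      by (simp add: pos_less_divide_eq mult.commute)
    have le: "\<tau> n (J n \<omega>) \<le> Y \<omega> + 1 / real (Suc n)" for n
    proof -
      have "\<tau> n (J n \<omega>) \<le> (real (Suc n) * Y \<omega> + 1) / real (Suc n)"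
        unfolding \<tau>_def J_eq by (intro divide_right_mono add_mono of_int_floor_le) auto
      then show ?thesis by (simp add: add_divide_distrib del: of_nat_Suc)
    qed
    have "(\<lambda>n. Y \<omega> + 1 / real (Suc n)) \<longlonglongrightarrow> Y \<omega> + 0"
      by (intro tendsto_intros LIMSEQ_Suc[OF lim_1_over_n])
    then have "(\<lambda>n. \<tau> n (J n \<omega>)) \<longlonglongrightarrow> Y \<omega>"
      using gt le by (intro tendsto_sandwich[OF _ _ tendsto_const, of _ "\<lambda>n. \<tau> n (J n \<omega>)" _ "\<lambda>n. Y \<omega> + 1 / real (Suc n)"])
        (auto intro!: always_eventually less_imp_le)
    then show ?thesis
      using gt by (simp add: filterlim_at less_imp_neq[THEN not_sym])
  qed
  have lim_E: "(\<lambda>n. indicator (E n) \<omega> :: real) \<longlonglongrightarrow> indicator E' \<omega>" if \<omega>: "\<omega> \<in> space M" for \<omega>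
  proof -
    have "\<forall>\<^sub>F n in sequentially. X (\<tau> n (J n \<omega>)) \<omega> = X (Y \<omega>) \<omega>"
      using eventually_compose_filterlim[OF rc[OF \<omega> Y0[OF \<omega>]] \<tau>_lim[OF \<omega>]] .
    then show ?thesis
      by (intro tendsto_eventually) (auto elim!: eventually_mono simp: E_def E'_def indicator_def)
  qed
  have lim_p: "(\<lambda>n. p (\<tau> n (J n \<omega>))) \<longlonglongrightarrow> p (Y \<omega>)" if \<omega>: "\<omega> \<in> space M" for \<omega>
    using \<tau>_lim[OF \<omega>] Y0[OF \<omega>] \<tau>0
    by (intro continuous_on_tendsto_compose[OF cont]) (auto simp: filterlim_at)
  have meas_E': "(\<lambda>\<omega>. indicator E' \<omega> :: real) \<in> borel_measurable M"
    by (rule borel_measurable_LIMSEQ_real[OF lim_E]) auto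
  have meas_p: "(\<lambda>\<omega>. p (Y \<omega>)) \<in> borel_measurable M"
    by (rule borel_measurable_LIMSEQ_real[OF lim_p]) (auto intro: measurable_compose[OF J])
  have E'[measurable]: "E' \<in> events"
  proof -
    have "E' \<inter> space M = E'" by (auto simp: E'_def)
    then show ?thesis using meas_E' by (simp add: borel_measurable_indicator_iff)
  qed
  have "(\<lambda>n. expectation (indicator (E n))) \<longlonglongrightarrow> expectation (indicator E' :: 'a \<Rightarrow> real)"
    using lim_E by (intro integral_dominated_convergence[where w = "\<lambda>_. 1"]) auto
  moreover have "(\<lambda>n. expectation (\<lambda>\<omega>. p (\<tau> n (J n \<omega>)))) \<longlonglongrightarrow> expectation (\<lambda>\<omega>. p (Y \<omega>))"
    using lim_p meas_p p01[OF \<tau>0] by (intro integral_dominated_convergence[where w = "\<lambda>_. 1"])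
      (auto intro: measurable_compose[OF J])
  ultimately have "expectation (indicator E') = expectation (\<lambda>\<omega>. p (Y \<omega>))"
    by (intro LIMSEQ_unique[of "\<lambda>n. prob (E n)"]) (simp_all add: prob_E)
  with E' show "{\<omega> \<in> space M. X (Y \<omega>) \<omega> = x} \<in> events"
    and "prob {\<omega> \<in> space M. X (Y \<omega>) \<omega> = x} = expectation (\<lambda>\<omega>. p (Y \<omega>))"
    by (simp_all flip: E'_def)
qed

lemma (in prob_space) indep_processes_prob:
  assumes "indep_processes N\<^sub>1 X N\<^sub>2 Y" and t: "0 \<le> u" "0 \<le> t" and A: "A \<in> sets N\<^sub>1" and B: "B \<in> sets N\<^sub>2"
  shows "prob ({\<omega> \<in> space M. X u \<omega> \<in> A} \<inter> {\<omega> \<in> space M. Y t \<omega> \<in> B}) =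
    prob {\<omega> \<in> space M. X u \<omega> \<in> A} * prob {\<omega> \<in> space M. Y t \<omega> \<in> B}"
proof -
  have in_alg: "{\<omega> \<in> space M. Z v \<omega> \<in> C} \<in> sets (process_algebra M N Z)"
    if rv: "\<forall>t\<ge>0. random_variable N (Z t)" and v: "0 \<le> v" and C: "C \<in> sets N"
    for N :: "'d measure" and Z :: "real \<Rightarrow> 'a \<Rightarrow> 'd" and v :: real and C
  proof -
    let ?Pi = "Pi\<^sub>M {0..} (\<lambda>_. N)"
    have "(\<lambda>f. f v) -` C \<inter> space ?Pi \<in> sets ?Pi"
      using v C by (intro measurable_sets[OF measurable_component_singleton]) auto
    then have "(\<lambda>\<omega>. \<lambda>t\<in>{0..}. Z t \<omega>) -` ((\<lambda>f. f v) -` C \<inter> space ?Pi) \<inter> space M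
        \<in> sets (process_algebra M N Z)"
      unfolding process_algebra_def by (rule in_vimage_algebra)
    also have "(\<lambda>\<omega>. \<lambda>t\<in>{0..}. Z t \<omega>) -` ((\<lambda>f. f v) -` C \<inter> space ?Pi) \<inter> space M =
        {\<omega> \<in> space M. Z v \<omega> \<in> C}"
      using rv v by (auto simp: space_PiM PiE_def dest: measurable_space)
    finally show ?thesis .
  qed
  from assms(1) have rv: "\<forall>t\<ge>0. random_variable N\<^sub>1 (X t)" "\<forall>t\<ge>0. random_variable N\<^sub>2 (Y t)"
    and ind: "indep_set (sets (process_algebra M N\<^sub>1 X)) (sets (process_algebra M N\<^sub>2 Y))"
    unfolding indep_processes_def by auto
  show ?thesis
    using indep_setD[OF ind in_alg[OF rv(1) t(1) A] in_alg[OF rv(2) t(2) B]] .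
qed

section \<open>The Erlang queue\<close>

text \<open>The customer in service has \<open>c\<close> phases left, every waiting one has
  \<open>k\<close>.\<close>

definition erlang_phases :: "nat \<Rightarrow> nat \<times> nat \<Rightarrow> nat" where
  "erlang_phases k i = (case i of (n, c) \<Rightarrow> if n = 0 then 0 else (n - 1) * k + c)"

text \<open>All service moves, whether or not they end a service, have rate \<open>k * mu\<close>
  and lower \<open>erlang_phases k\<close> by one, so one successor stands for all of them.\<close>

definition erlang_pred :: "nat \<Rightarrow> nat \<times> nat \<Rightarrow> nat \<times> nat" where
  "erlang_pred k i = (case i of (n, c) \<Rightarrow>
    if 2 \<le> c then (n, c - 1) else if 2 \<le> n then (n - 1, k) else (0, 0))"

text \<open>The factor a / (s + a) increases with \<open>a\<close>. Hence the empty state, left at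
  rate \<open>lam\<close>, and the busy states, left at rate \<open>lam + k * mu\<close>, share the
  factor of the larger rate.\<close>

lemma resolvent_contraction:
  fixes s a A y v b :: real
  assumes "0 < s" "0 \<le> a" "a \<le> A" "(s + a) * y = v" "\<bar>v\<bar> \<le> a * b" "0 \<le> b"
  shows "\<bar>y\<bar> \<le> A / (s + A) * b"
proof -
  have "(s + a) * \<bar>y\<bar> = \<bar>v\<bar>"
    using assms by (auto simp: abs_mult)
  then have "\<bar>y\<bar> \<le> a * b / (s + a)"
    using assms by (simp add: field_simps)
  also have "\<dots> = a / (s + a) * b" by simp
  also have "\<dots> \<le> A / (s + A) * b"
    using assms by (intro mult_right_mono) (auto simp: field_simps)
  finally show ?thesis .
qed

section \<open>The resolvent at the empty state, in closed form and as a double series\<close>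

context
  fixes lam mu s :: real and k :: nat and P and R :: "nat \<times> nat \<Rightarrow> real"
  assumes lam: "0 < lam" and mu: "0 < mu" and k: "1 \<le> k" and s: "0 < s"
    and P: "transition_semigroup (erlang_states k) P"
      "has_transition_rates (erlang_states k) P (erlang_rate lam mu k)"
  defines "R \<equiv> \<lambda>i. laplace_transform (\<lambda>t. pmf (P t i) (0, 0)) s"
begin

lemma erlang_resolvent_empty: "(s + lam) * R (0, 0) = 1 + lam * R (1, k)"
  unfolding R_def
  using resolvent_equation[OF P _ s, of "(0, 0)" "{(1, k)}" "(0, 0)"] k
  by (auto simp: erlang_states_def erlang_rate_def)

lemma erlang_resolvent_busy:
  assumes "1 \<le> n" "1 \<le> c" "c \<le> k"
  shows "(s + (lam + real k * mu)) * R (n, c) = lam * R (n + 1, c) + real k * mu * R (erlang_pred k (n, c))"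
proof -
  have ne: "(n + 1, c) \<noteq> erlang_pred k (n, c)"
    by (auto simp: erlang_pred_def)
  have rates: "erlang_rate lam mu k (n, c) (n + 1, c) = lam"
    "erlang_rate lam mu k (n, c) (erlang_pred k (n, c)) = real k * mu"
    using assms by (auto simp: erlang_rate_def erlang_pred_def)
  have eq: "(s + sum (erlang_rate lam mu k (n, c)) {(n + 1, c), erlang_pred k (n, c)}) * R (n, c) =
    of_bool ((n, c) = (0, 0)) + (\<Sum>l\<in>{(n + 1, c), erlang_pred k (n, c)}. erlang_rate lam mu k (n, c) l * R l)"
    unfolding R_def
  proof (rule resolvent_equation[OF P _ s])
    show "(n, c) \<in> erlang_states k" "{(n + 1, c), erlang_pred k (n, c)} \<subseteq> erlang_states k - {(n, c)}"
      using assms k by (auto simp: erlang_states_def erlang_pred_def)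
    show "erlang_rate lam mu k (n, c) l = 0"
      if "l \<in> erlang_states k - {(n, c)} - {(n + 1, c), erlang_pred k (n, c)}" for l
      using that assms by (auto simp: erlang_rate_def erlang_pred_def)
  qed simp
  have sum2: "sum f {(n + 1, c), erlang_pred k (n, c)} = f (n + 1, c) + f (erlang_pred k (n, c))"
    for f :: "_ \<Rightarrow> real"
    using ne by (subst sum.insert) auto
  have "(n, c) \<noteq> (0, 0)"
    using assms by simp
  then show ?thesis
    using eq unfolding sum2 rates by simp
qed

text \<open>
  The number of remaining service phases is a walk with upward jumps of size \<open>k\<close> at rate \<open>lam\<close> and unit
  downward steps at rate \<open>k * mu\<close>, so its resolvent decays geometrically in the starting level.
\<close>

lemma erlang_resolvent_zero:
  fixes \<rho> :: real
  assumes \<rho>: "0 < \<rho>" "\<rho> < 1"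
    and root: "(lam + real k * mu + s) * \<rho> = real k * mu + lam * \<rho> ^ (k + 1)"
  shows "R (0, 0) = \<rho> / (real k * mu * (1 - \<rho>))"
proof -
  define \<kappa> where "\<kappa> = real k * mu"
  have \<kappa>: "0 < \<kappa>" using k mu by (simp add: \<kappa>_def)
  \<comment> \<open>Any multiple of \<rho>^l solves the busy equations by the root equation; the
    equation of the empty state, with its source term 1, fixes the multiple.\<close>
  define x where "x = \<rho> / (\<kappa> * (1 - \<rho>))"
  define V where "V i = x * \<rho> ^ erlang_phases k i" for i
  have x0: "0 < x" using \<rho> \<kappa> by (simp add: x_def)
  have V_empty: "(s + lam) * V (0, 0) = 1 + lam * V (1, k)"
  proof -
    have "\<rho> * ((s + lam) - lam * \<rho> ^ k) = \<kappa> * (1 - \<rho>)"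
      using root by (simp add: \<kappa>_def algebra_simps)
    then have "x * ((s + lam) - lam * \<rho> ^ k) = 1"
      using \<rho> \<kappa> by (simp add: x_def)
    then show ?thesis
      by (simp add: V_def erlang_phases_def algebra_simps)
  qed
  have V_busy: "(s + (lam + \<kappa>)) * V (n, c) = lam * V (n + 1, c) + \<kappa> * V (erlang_pred k (n, c))"
    if "1 \<le> n" "1 \<le> c" "c \<le> k" for n c
  proof -
    define l where "l = erlang_phases k (erlang_pred k (n, c))"
    obtain n' where n': "n = Suc n'" using \<open>1 \<le> n\<close> by (cases n) auto
    have "erlang_phases k (n, c) = Suc l"
      using that by (cases n') (auto simp: l_def erlang_phases_def erlang_pred_def n')
    moreover have "erlang_phases k (n + 1, c) = erlang_phases k (n, c) + k"
      using that by (simp add: erlang_phases_def n')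
    moreover have "(s + (lam + \<kappa>)) * (x * \<rho> ^ Suc l) = lam * (x * \<rho> ^ (Suc l + k)) + \<kappa> * (x * \<rho> ^ l)"
    proof -
      have "(s + (lam + \<kappa>)) * (x * \<rho> ^ Suc l) = x * \<rho> ^ l * ((lam + \<kappa> + s) * \<rho>)"
        by (simp add: algebra_simps)
      also have "(lam + \<kappa> + s) * \<rho> = \<kappa> + lam * \<rho> ^ (k + 1)"
        using root by (simp only: \<kappa>_def)
      finally show ?thesis by (simp add: power_add algebra_simps)
    qed
    ultimately show ?thesis
      by (simp only: V_def l_def)
  qed
  have R01: "\<bar>R i\<bar> \<le> 1 / s" if "i \<in> erlang_states k" for i
    using laplace_transform_bounds[OF s continuous_on_transition[OF P that], of 0 "(0, 0)" 1]
    by (simp add: R_def pmf_le_1)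
  have V01: "\<bar>V i\<bar> \<le> x" for i
  proof -
    have "x * \<rho> ^ erlang_phases k i \<le> x * 1"
      using \<rho> x0 by (intro mult_left_mono power_le_one) auto
    then show ?thesis using \<rho> x0 by (simp add: V_def abs_mult)
  qed
  \<comment> \<open>The source term cancels in the difference, which is bounded because
    probabilities have transforms at most 1 / s.\<close>
  have "R (0, 0) - V (0, 0) = 0"
  proof (rule contraction_imp_zero[of "erlang_states k" "\<lambda>i. R i - V i" "1 / s + x" "(lam + \<kappa>) / (s + (lam + \<kappa>))"])
    show "\<bar>R i - V i\<bar> \<le> 1 / s + x" if "i \<in> erlang_states k" for i
      using R01[OF that] V01[of i] by linarith
  next
    fix b i
    assume b: "\<And>j. j \<in> erlang_states k \<Longrightarrow> \<bar>R j - V j\<bar> \<le> b" and i: "i \<in> erlang_states k"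
    have b0: "0 \<le> b" using b[OF i] by linarith
    show "\<bar>R i - V i\<bar> \<le> (lam + \<kappa>) / (s + (lam + \<kappa>)) * b"
    proof (cases "i = (0, 0)")
      case True
      have "(s + lam) * (R i - V i) = lam * (R (1, k) - V (1, k))"
        using erlang_resolvent_empty V_empty by (simp add: True algebra_simps)
      moreover have "\<bar>lam * (R (1, k) - V (1, k))\<bar> \<le> lam * b"
        using b[of "(1, k)"] k lam by (simp add: abs_mult erlang_states_def)
      ultimately show ?thesis
        using lam \<kappa> by (intro resolvent_contraction[OF s _ _ _ _ b0, where a=lam]) auto
    next
      case False
      then obtain n c where i_eq: "i = (n, c)" and nc: "1 \<le> n" "1 \<le> c" "c \<le> k"
        using i by (auto simp: erlang_states_def)
      have st: "(n + 1, c) \<in> erlang_states k" "erlang_pred k (n, c) \<in> erlang_states k"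
        using nc by (auto simp: erlang_states_def erlang_pred_def)
      have "(s + (lam + \<kappa>)) * (R i - V i) =
          lam * (R (n + 1, c) - V (n + 1, c)) + \<kappa> * (R (erlang_pred k (n, c)) - V (erlang_pred k (n, c)))"
        using erlang_resolvent_busy[OF nc] V_busy[OF nc] unfolding i_eq \<kappa>_def by (simp add: algebra_simps)
      moreover have "\<bar>lam * (R (n + 1, c) - V (n + 1, c)) + \<kappa> * (R (erlang_pred k (n, c)) - V (erlang_pred k (n, c)))\<bar>
          \<le> (lam + \<kappa>) * b"
      proof -
        have "\<bar>lam * (R (n + 1, c) - V (n + 1, c))\<bar> \<le> lam * b"
          "\<bar>\<kappa> * (R (erlang_pred k (n, c)) - V (erlang_pred k (n, c)))\<bar> \<le> \<kappa> * b"
          using b[OF st(1)] b[OF st(2)] lam \<kappa> by (simp_all add: abs_mult)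
        then show ?thesis unfolding distrib_right by linarith
      qed
      ultimately show ?thesis
        using lam \<kappa> by (intro resolvent_contraction[OF s _ order_refl _ _ b0]) auto
    qed
  qed (use lam \<kappa> s in \<open>auto simp: erlang_states_def\<close>)
  then show ?thesis
    by (simp add: V_def erlang_phases_def x_def \<kappa>_def)
qed

text \<open>Dividing the root equation by \<open>w\<close> gives \<rho> = p + q * \<rho>^(k + 1)
  with p + q = 1 - s / w. The closed form is a geometric series in the powers
  \<open>\<rho> ^ Suc m\<close>, each a Raney series; its factor 1 / \<kappa> accounts for the
  \<open>- 1\<close> in the exponent of \<open>k * mu\<close> in \<open>A0\<close>.\<close>

lemma erlang_resolvent_series:
  "summable (\<lambda>r. A0 lam mu k (Suc m) r / (lam + real k * mu + s) ^ a0 k (Suc m) r)"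
  "(\<lambda>m. \<Sum>r. A0 lam mu k (Suc m) r / (lam + real k * mu + s) ^ a0 k (Suc m) r) sums R (0, 0)"
proof -
  define \<kappa> where "\<kappa> = real k * mu"
  define w where "w = lam + \<kappa> + s"
  define p q where "p = \<kappa> / w" and "q = lam / w"
  have \<kappa>: "0 < \<kappa>" using k mu by (simp add: \<kappa>_def)
  have w: "0 < w" using lam \<kappa> s by (simp add: w_def)
  have pq: "0 < p" "0 < q"
    using \<kappa> lam w by (simp_all add: p_def q_def)
  have pq1: "p + q < 1"
    using s w unfolding p_def q_def add_divide_distrib[symmetric] by (simp add: w_def)
  \<comment> \<open>The function is p > 0 at 0 and p + q - 1 < 0 at 1.\<close>
  have "\<exists>x\<ge>0. x \<le> 1 \<and> p + q * x ^ (k + 1) - x = 0"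
    using pq pq1 by (intro IVT2') (auto intro!: continuous_intros)
  then obtain \<rho> where \<rho>: "0 \<le> \<rho>" "\<rho> \<le> 1" "\<rho> = p + q * \<rho> ^ (k + 1)"
    by (auto simp: algebra_simps)
  have \<rho>0: "0 < \<rho>"
    using pq \<rho> by (subst \<rho>(3)) (intro add_pos_nonneg; simp)
  have \<rho>1: "\<rho> < 1"
    using \<rho> pq1 by (cases "\<rho> = 1") auto
  have root: "w * \<rho> = \<kappa> + lam * \<rho> ^ (k + 1)"
    using w by (subst \<rho>(3)) (simp add: p_def q_def field_simps)
  have R0: "R (0, 0) = \<rho> / (\<kappa> * (1 - \<rho>))"
    unfolding \<kappa>_def by (rule erlang_resolvent_zero[OF \<rho>0 \<rho>1]) (use root in \<open>simp add: w_def \<kappa>_def\<close>)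
  have term_eq: "A0 lam mu k (Suc m) r / w ^ a0 k (Suc m) r =
      raney k (Suc m) r * q ^ r * p ^ (Suc m + r * k) / \<kappa>" for m r
  proof -
    \<comment> \<open>Of the \<open>a0\<close> factors \<open>w\<close>, \<open>r\<close> belong to
      powers of \<open>q\<close> and the others to powers of \<open>p\<close>.\<close>
    have "w ^ a0 k (Suc m) r = w ^ r * w ^ (Suc m + r * k)"
      unfolding power_add[symmetric] by (simp add: a0_def algebra_simps)
    then show ?thesis
      using \<kappa> unfolding A0_def raney_def p_def q_def \<kappa>_def[symmetric]
      by (simp add: power_divide mult_ac)
  qed
  have sums: "(\<lambda>r. A0 lam mu k (Suc m) r / w ^ a0 k (Suc m) r) sums (\<rho> ^ Suc m / \<kappa>)" for m
    unfolding term_eq using pq pq1 \<rho> by (intro sums_divide raney_sums) auto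
  have "(\<lambda>m. \<rho> / \<kappa> * \<rho> ^ m) sums (\<rho> / \<kappa> * (1 / (1 - \<rho>)))"
    using \<rho>0 \<rho>1 by (intro sums_mult geometric_sums) auto
  then have "(\<lambda>m. \<rho> ^ Suc m / \<kappa>) sums R (0, 0)"
    by (simp add: R0)
  then show "(\<lambda>m. \<Sum>r. A0 lam mu k (Suc m) r / (lam + real k * mu + s) ^ a0 k (Suc m) r) sums R (0, 0)"
    using sums_unique[OF sums] by (simp add: w_def \<kappa>_def)
  show "summable (\<lambda>r. A0 lam mu k (Suc m) r / (lam + real k * mu + s) ^ a0 k (Suc m) r)"
    using sums_summable[OF sums] by (simp add: w_def \<kappa>_def)
qed

end

text \<open>Conditioning on an almost sure initial state does not change the probability. The time 0
  is separate because the Markov property speaks of strictly increasing times.\<close>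

lemma (in prob_space) markov_chain_transition_prob:
  assumes Q: "random_variable (count_space S) (Q 0)"
    and init: "AE \<omega> in M. Q 0 \<omega> = i" and P: "transition_semigroup S P"
    and markov: "\<And>(n::nat) (t::nat \<Rightarrow> real) (x::nat \<Rightarrow> 's). 0 \<le> t 0 \<Longrightarrow> (\<forall>m\<le>n. t m < t (Suc m)) \<Longrightarrow>
           \<P>(\<omega> in M. \<forall>m\<le>n. Q (t m) \<omega> = x m) \<noteq> 0 \<Longrightarrow>
           \<P>(\<omega> in M. Q (t (Suc n)) \<omega> = x (Suc n) \<bar> \<forall>m\<le>n. Q (t m) \<omega> = x m)
             = pmf (P (t (Suc n) - t n) (x n)) (x (Suc n))"
    and i: "i \<in> S" and u: "0 \<le> u" and Qu: "random_variable (count_space S) (Q u)" and j: "j \<in> S"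
  shows "prob {\<omega> \<in> space M. Q u \<omega> = j} = pmf (P u i) j"
proof (cases "u = 0")
  case True
  have "prob {\<omega> \<in> space M. Q 0 \<omega> = j} = prob {\<omega> \<in> space M. i = j}"
    using init Q j by (intro finite_measure_eq_AE) (auto elim!: eventually_mono)
  moreover have "P 0 i = return_pmf i"
    using P i unfolding transition_semigroup_def by blast
  ultimately show ?thesis
    using True by (simp add: prob_space indicator_def)
next
  case False
  have [measurable]: "{\<omega> \<in> space M. Q 0 \<omega> = i} \<in> events" "{\<omega> \<in> space M. Q u \<omega> = j} \<in> events"
    using Q Qu i j by measurable
  have 1: "prob {\<omega> \<in> space M. Q 0 \<omega> = i} = 1"
    using init by (subst prob_Collect_eq_1) auto
  have "\<P>(\<omega> in M. Q u \<omega> = j \<bar> Q 0 \<omega> = i) = pmf (P u i) j"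
    \<comment> \<open>Only the first two members of the sequence enter, the times 0 and
      \<open>u\<close>.\<close>
    using markov[of "\<lambda>m. real m * u" 0 "\<lambda>m. if m = 0 then i else j"] u False 1 by simp
  moreover have "prob {\<omega> \<in> space M. Q u \<omega> = j \<and> Q 0 \<omega> = i} = prob {\<omega> \<in> space M. Q u \<omega> = j}"
    using init by (intro finite_measure_eq_AE) (auto elim!: eventually_mono)
  ultimately show ?thesis
    by (simp add: cond_prob_def 1)
qed

theorem proposition3p1:
  fixes M :: "'a measure"
    and Q :: "real \<Rightarrow> 'a \<Rightarrow> nat \<times> nat"
    and D :: "real \<Rightarrow> 'a \<Rightarrow> real"
    and lam mu c\<^sub>1 c\<^sub>2 \<alpha>\<^sub>1 \<alpha>\<^sub>2 z :: real
    and k :: nat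
  assumes "prob_space M"
    and "0 < lam" and "0 < mu" and "1 \<le> k"
    and "0 < \<alpha>\<^sub>2" and "\<alpha>\<^sub>2 < \<alpha>\<^sub>1" and "\<alpha>\<^sub>1 < 1"
    and "0 \<le> c\<^sub>1" and "0 \<le> c\<^sub>2" and "c\<^sub>1 + c\<^sub>2 = 1"
    and "prob_space.erlang_queue M lam mu k Q"
    and "prob_space.mixed_stable_subordinator M c\<^sub>1 c\<^sub>2 \<alpha>\<^sub>1 \<alpha>\<^sub>2 D"
    and "prob_space.indep_processes M
           (count_space (erlang_states k)) Q borel (inverse_process D)"
    and "0 < z"
  shows "set_integrable lborel {0..}
           (\<lambda>t. exp (- z * t) * zero_state_prob M (time_change Q (inverse_process D)) t) \<and>
         (\<forall>m\<ge>1. summable (zero_state_term lam mu k c\<^sub>1 c\<^sub>2 \<alpha>\<^sub>1 \<alpha>\<^sub>2 z m)) \<and>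
         (\<lambda>m. \<Sum>r. zero_state_term lam mu k c\<^sub>1 c\<^sub>2 \<alpha>\<^sub>1 \<alpha>\<^sub>2 z (Suc m) r)
           sums laplace_transform (zero_state_prob M (time_change Q (inverse_process D))) z"
proof -
  interpret prob_space M by fact
  note lam = \<open>0 < lam\<close> and mu = \<open>0 < mu\<close> and k = \<open>1 \<le> k\<close> and z = \<open>0 < z\<close>
  let ?S = "erlang_states k" and ?Y = "inverse_process D"
  have S: "(0, 0) \<in> ?S" by (simp add: erlang_states_def)
  have Q_rv: "\<And>t. 0 \<le> t \<Longrightarrow> random_variable (count_space ?S) (Q t)"
    and Q_rc: "\<And>\<omega> t. \<omega> \<in> space M \<Longrightarrow> 0 \<le> t \<Longrightarrow> \<forall>\<^sub>F s in at_right t. Q s \<omega> = Q t \<omega>"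
    and Q_0: "AE \<omega> in M. Q 0 \<omega> = (0, 0)"
    using \<open>erlang_queue lam mu k Q\<close> unfolding erlang_queue_def markov_chain_def by blast+
  obtain P where P: "transition_semigroup ?S P" "has_transition_rates ?S P (erlang_rate lam mu k)"
    and markov: "\<And>(n::nat) (t::nat \<Rightarrow> real) x. 0 \<le> t 0 \<Longrightarrow> (\<forall>m\<le>n. t m < t (Suc m)) \<Longrightarrow>
           \<P>(\<omega> in M. \<forall>m\<le>n. Q (t m) \<omega> = x m) \<noteq> 0 \<Longrightarrow>
           \<P>(\<omega> in M. Q (t (Suc n)) \<omega> = x (Suc n) \<bar> \<forall>m\<le>n. Q (t m) \<omega> = x m)
             = pmf (P (t (Suc n) - t n) (x n)) (x (Suc n))"
    using \<open>erlang_queue lam mu k Q\<close> unfolding erlang_queue_def markov_chain_def by blast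
  define p where "p u = pmf (P u (0, 0)) (0, 0)" for u
  have p: "p u = prob {\<omega> \<in> space M. Q u \<omega> = (0, 0)}" if "0 \<le> u" for u
    unfolding p_def
    by (rule markov_chain_transition_prob[OF Q_rv Q_0 P(1) markov, symmetric]) (use that S Q_rv in auto)
  have Q_ev: "{\<omega> \<in> space M. Q u \<omega> = (0, 0)} \<in> events" if "0 \<le> u" for u
    using Q_rv[OF that] S by measurable
  have p01: "\<bar>p u\<bar> \<le> 1" for u
    by (simp add: p_def pmf_le_1)
  have p_cont: "continuous_on {0..} p"
    unfolding p_def using continuous_on_transition[OF P S] .

  note D = \<open>mixed_stable_subordinator c\<^sub>1 c\<^sub>2 \<alpha>\<^sub>1 \<alpha>\<^sub>2 D\<close>[unfolded mixed_stable_subordinator_def levy_process_def]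
  define \<phi> where "\<phi> z = c\<^sub>1 * z powr \<alpha>\<^sub>1 + c\<^sub>2 * z powr \<alpha>\<^sub>2" for z
  have \<phi>_pos: "0 < \<phi> z" if "0 < z" for z
  proof -
    have "0 < c\<^sub>1 \<or> 0 < c\<^sub>2" using \<open>c\<^sub>1 + c\<^sub>2 = 1\<close> by linarith
    then show ?thesis
      using \<open>0 \<le> c\<^sub>1\<close> \<open>0 \<le> c\<^sub>2\<close> that by (auto simp: \<phi>_def intro: add_pos_nonneg add_nonneg_pos)
  qed
  have Y_rv: "random_variable borel (?Y t)" if "0 \<le> t" for t
    using that \<open>indep_processes (count_space ?S) Q borel ?Y\<close> unfolding indep_processes_def by blast
  define G where "G t = expectation (\<lambda>\<omega>. p (?Y t \<omega>))" for t
  have D_props: "\<And>t. 0 \<le> t \<Longrightarrow> random_variable borel (D t)"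
    "AE \<omega> in M. D 0 \<omega> = 0" "AE \<omega> in M. \<forall>s\<ge>0. \<forall>t\<ge>s. D s \<omega> \<le> D t \<omega>"
    "\<And>t z. 0 \<le> t \<Longrightarrow> 0 < z \<Longrightarrow> expectation (\<lambda>\<omega>. exp (- z * D t \<omega>)) = exp (- t * \<phi> z)"
    using D unfolding \<phi>_def by blast+
  have G_meas: "set_borel_measurable lborel {0..} G"
    and G_laplace: "laplace_transform G z = \<phi> z / z * laplace_transform p (\<phi> z)"
    unfolding G_def
    by (rule laplace_transform_inverse_process[OF D_props \<phi>_pos Y_rv z p_cont p01]; assumption)+

  have QY: "{\<omega> \<in> space M. Q (?Y t \<omega>) \<omega> = (0, 0)} \<in> events"
    "prob {\<omega> \<in> space M. Q (?Y t \<omega>) \<omega> = (0, 0)} = G t" if t: "0 \<le> t" for t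
  proof -
    have indep: "prob ({\<omega> \<in> space M. Q u \<omega> = (0, 0)} \<inter> {\<omega> \<in> space M. ?Y t \<omega> \<in> B}) =
        prob {\<omega> \<in> space M. Q u \<omega> = (0, 0)} * prob {\<omega> \<in> space M. ?Y t \<omega> \<in> B}"
      if "0 \<le> u" "B \<in> sets borel" for u B
      using indep_processes_prob[OF \<open>indep_processes (count_space ?S) Q borel ?Y\<close> that(1) t _ that(2), of "{(0, 0)}"] S
      by simp
    show "{\<omega> \<in> space M. Q (?Y t \<omega>) \<omega> = (0, 0)} \<in> events"
      "prob {\<omega> \<in> space M. Q (?Y t \<omega>) \<omega> = (0, 0)} = G t"
      unfolding G_def
      by (rule prob_at_independent_time[OF Q_ev Q_rc Y_rv[OF t] inverse_process_nonneg indep p p_cont]; assumption)+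
  qed
  have zero_state: "zero_state_prob M (time_change Q ?Y) t = G t" if t: "0 \<le> t" for t
  proof -
    \<comment> \<open>The conditioning event is therefore that \<open>Q\<close> itself starts in (0,
      0), which has probability one.\<close>
    have Y0: "?Y 0 \<omega> = 0" for \<omega>
      by (simp add: inverse_process_def)
    have [measurable]: "{\<omega> \<in> space M. Q 0 \<omega> = (0, 0)} \<in> events"
      "{\<omega> \<in> space M. Q (?Y t \<omega>) \<omega> = (0, 0)} \<in> events"
      by (rule Q_ev[OF order_refl], rule QY(1)[OF t])
    have "prob {\<omega> \<in> space M. Q (?Y t \<omega>) \<omega> = (0, 0) \<and> Q 0 \<omega> = (0, 0)} =
        prob {\<omega> \<in> space M. Q (?Y t \<omega>) \<omega> = (0, 0)}"
      using Q_0 by (intro finite_measure_eq_AE) (auto elim!: eventually_mono)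
    moreover have "prob {\<omega> \<in> space M. Q 0 \<omega> = (0, 0)} = 1"
      using Q_0 by (subst prob_Collect_eq_1) auto
    ultimately show ?thesis
      unfolding zero_state_prob_def time_change_def cond_prob_def by (simp only: Y0 QY(2)[OF t] div_by_1)
  qed

  have G01: "\<bar>G t\<bar> \<le> 1" if "0 \<le> t" for t
    unfolding QY(2)[OF that, symmetric] by simp
  have "set_integrable lborel {0..} (\<lambda>t. exp (- z * t) * G t)"
    using z G_meas G01 by (intro laplace_set_integrable) auto
  then have int: "set_integrable lborel {0..} (\<lambda>t. exp (- z * t) * zero_state_prob M (time_change Q ?Y) t)"
    by (subst set_integrable_cong[OF refl refl]) (auto simp: zero_state)
  have lap: "laplace_transform (zero_state_prob M (time_change Q ?Y)) z = \<phi> z / z * laplace_transform p (\<phi> z)"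
    unfolding G_laplace[symmetric] unfolding laplace_transform_def
    by (intro set_lebesgue_integral_cong) (auto simp: zero_state)

  note series = erlang_resolvent_series[OF lam mu k \<phi>_pos[OF z] P, folded p_def]
  \<comment> \<open>The numerator of each term is exactly the factor produced by the time
    change.\<close>
  have \<phi>_div: "c\<^sub>1 * z powr (\<alpha>\<^sub>1 - 1) + c\<^sub>2 * z powr (\<alpha>\<^sub>2 - 1) = \<phi> z / z"
    using z by (simp add: \<phi>_def powr_diff add_divide_distrib)
  have term_eq: "zero_state_term lam mu k c\<^sub>1 c\<^sub>2 \<alpha>\<^sub>1 \<alpha>\<^sub>2 z m r =
      \<phi> z / z * (A0 lam mu k m r / (lam + real k * mu + \<phi> z) ^ a0 k m r)" for m r
    unfolding zero_state_term_def \<phi>_div by (simp add: \<phi>_def add.assoc)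
  have "summable (zero_state_term lam mu k c\<^sub>1 c\<^sub>2 \<alpha>\<^sub>1 \<alpha>\<^sub>2 z m)" if "1 \<le> m" for m
    unfolding term_eq[abs_def] using series(1)[of "m - 1"] that by (intro summable_mult) simp
  moreover have "(\<lambda>m. \<Sum>r. zero_state_term lam mu k c\<^sub>1 c\<^sub>2 \<alpha>\<^sub>1 \<alpha>\<^sub>2 z (Suc m) r) sums
      (\<phi> z / z * laplace_transform p (\<phi> z))"
    unfolding term_eq suminf_mult[OF series(1)] using series(2) by (intro sums_mult) (simp add: p_def[abs_def])
  ultimately show ?thesis
    using int lap by simp
qed

end
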